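(* Let $\mathcal{C}$ be a prevariety over a finite alphabet $A$. Then $\mathit{SF}(\mathcal{C}) = \mathrm{LTL}(\mathcal{C}) = \mathrm{LTLP}(\mathcal{C})$.
   Context: Fix a finite alphabet $A$. A prevariety is a class of regular languages over $A$ containing $\emptyset$ and $A^*$, closed under union, intersection, complement, and under the quotients $u^{-1}L=\{w\mid uw\in L\}$ and $Lu^{-1}=\{w\mid wu\in L\}$. $\mathit{SF}(\mathcal{C})$ is the least class containing $\mathcal{C}$ and all $\{a\}$ ($a\in A$), closed under union, complement and concatenation. A word $w=a_1\cdots a_n$ has positions $\{0,\dots,n+1\}$, position $i\in\{1,\dots,n\}$ carrying label $a_i$, and $0$, $n+1$ unlabeled; for $i<j$, $w(i,j)=a_{i+1}\cdots a_{j-1}$. Formulas of $\mathrm{LTLP}[\mathcal{C}]$ are built from atomic formulas $\top$, $\mathit{min}$, $\mathit{max}$ and $a$ ($a\in A$) using $\vee,\wedge,\neg$ and, for each $L\in\mathcal{C}$, binary modalities $\psi_1\,\mathrm{U}_L\,\psi_2$ (until) and $\psi_1\,\mathrm{S}_L\,\psi_2$ (since). Semantics at a position $i$ of $w$: $\top$ always holds; $a$ holds iff $i$ is labeled $a$; $\mathit{min}$ holds iff $i=0$; $\mathit{max}$ holds iff $i=n+1$; Boolean connectives as usual; $w,i\models\psi_1\,\mathrm{U}_L\,\psi_2$ iff there is $j>i$ with $w(i,j)\in L$, $w,j\models\psi_2$ and $w,k\models\psi_1$ for all $i<k<j$; $w,i\models\psi_1\,\mathrm{S}_L\,\psi_2$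 iff there is $j<i$ with $w(j,i)\in L$, $w,j\models\psi_2$ and $w,k\models\psi_1$ for all $j<k<i$. A formula $\varphi$ defines the language $\{w\mid w,0\models\varphi\}$. $\mathrm{LTL}[\mathcal{C}]$ is the set of $\mathrm{LTLP}[\mathcal{C}]$ formulas without any since-modality. $\mathrm{LTL}(\mathcal{C})$ (resp. $\mathrm{LTLP}(\mathcal{C})$) is the class of languages defined by $\mathrm{LTL}[\mathcal{C}]$ (resp. $\mathrm{LTLP}[\mathcal{C}]$) formulas. *)

theory Defs
  imports Main
begin

text \<open>The finite alphabet A is the universe of a type variable of sort finite;
words are lists, languages are sets of lists.\<close>

definition conc :: "'a list set \<Rightarrow> 'a list set \<Rightarrow> 'a list set" where
  "conc L K = {u @ v | u v. u \<in> L \<and> v \<in> K}"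

inductive_set kstar :: "'a list set \<Rightarrow> 'a list set" for L where
  kstar_nil: "[] \<in> kstar L"
| kstar_app: "u \<in> L \<Longrightarrow> v \<in> kstar L \<Longrightarrow> u @ v \<in> kstar L"

inductive regular :: "'a list set \<Rightarrow> bool" where
  reg_empty: "regular {}"
| reg_eps: "regular {[]}"
| reg_letter: "regular {[a]}"
| reg_union: "regular L \<Longrightarrow> regular K \<Longrightarrow> regular (L \<union> K)"
| reg_conc: "regular L \<Longrightarrow> regular K \<Longrightarrow> regular (conc L K)"
| reg_star: "regular L \<Longrightarrow> regular (kstar L)"

definition lquot :: "'a list \<Rightarrow> 'a list set \<Rightarrow> 'a list set" where
  "lquot u L = {w. u @ w \<in> L}"

definition rquot :: "'a list set \<Rightarrow> 'a list \<Rightarrow> 'a list set" where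
  "rquot L u = {w. w @ u \<in> L}"

definition prevariety :: "('a::finite) list set set \<Rightarrow> bool" where
  "prevariety C \<longleftrightarrow>
     (\<forall>L\<in>C. regular L) \<and> {} \<in> C \<and> UNIV \<in> C \<and>
     (\<forall>L\<in>C. \<forall>K\<in>C. L \<union> K \<in> C) \<and>
     (\<forall>L\<in>C. \<forall>K\<in>C. L \<inter> K \<in> C) \<and>
     (\<forall>L\<in>C. - L \<in> C) \<and>
     (\<forall>L\<in>C. \<forall>u. lquot u L \<in> C) \<and>
     (\<forall>L\<in>C. \<forall>u. rquot L u \<in> C)"

inductive_set SF :: "('a::finite) list set set \<Rightarrow> 'a list set set" for C where
  SF_base: "L \<in> C \<Longrightarrow> L \<in> SF C"
| SF_letter: "{[a]} \<in> SF C"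
| SF_union: "L \<in> SF C \<Longrightarrow> K \<in> SF C \<Longrightarrow> L \<union> K \<in> SF C"
| SF_compl: "L \<in> SF C \<Longrightarrow> - L \<in> SF C"
| SF_conc: "L \<in> SF C \<Longrightarrow> K \<in> SF C \<Longrightarrow> conc L K \<in> SF C"

datatype 'a ltlp =
    TT | Min | Max | Lab 'a
  | Or "'a ltlp" "'a ltlp" | And "'a ltlp" "'a ltlp" | Neg "'a ltlp"
  | Until "'a list set" "'a ltlp" "'a ltlp"
  | Since "'a list set" "'a ltlp" "'a ltlp"

text \<open>Infix w(i,j) = a_{i+1} ... a_{j-1} for positions i < j of w.\<close>
definition infx :: "'a list \<Rightarrow> nat \<Rightarrow> nat \<Rightarrow> 'a list" where
  "infx w i j = take (j - i - 1) (drop i w)"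

text \<open>Positions of w are 0..length w + 1; position i with 1 \<le> i \<le> length w
carries label w ! (i - 1).\<close>
primrec sat :: "'a list \<Rightarrow> nat \<Rightarrow> 'a ltlp \<Rightarrow> bool" where
  "sat w i TT = True"
| "sat w i Min = (i = 0)"
| "sat w i Max = (i = length w + 1)"
| "sat w i (Lab a) = (1 \<le> i \<and> i \<le> length w \<and> w ! (i - 1) = a)"
| "sat w i (Or p q) = (sat w i p \<or> sat w i q)"
| "sat w i (And p q) = (sat w i p \<and> sat w i q)"
| "sat w i (Neg p) = (\<not> sat w i p)"
| "sat w i (Until L p q) = (\<exists>j. i < j \<and> j \<le> length w + 1 \<and> infx w i j \<in> L \<and> sat w j q \<and>
                              (\<forall>k. i < k \<and> k < j \<longrightarrow> sat w k p))"
| "sat w i (Since L p q) = (\<exists>j. j < i \<and> infx w j i \<in> L \<and> sat w j q \<and>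
                              (\<forall>k. j < k \<and> k < i \<longrightarrow> sat w k p))"

primrec mlangs :: "'a ltlp \<Rightarrow> 'a list set set" where
  "mlangs TT = {}" | "mlangs Min = {}" | "mlangs Max = {}" | "mlangs (Lab a) = {}"
| "mlangs (Or p q) = mlangs p \<union> mlangs q"
| "mlangs (And p q) = mlangs p \<union> mlangs q"
| "mlangs (Neg p) = mlangs p"
| "mlangs (Until L p q) = insert L (mlangs p \<union> mlangs q)"
| "mlangs (Since L p q) = insert L (mlangs p \<union> mlangs q)"

primrec future :: "'a ltlp \<Rightarrow> bool" where
  "future TT = True" | "future Min = True" | "future Max = True" | "future (Lab a) = True"
| "future (Or p q) = (future p \<and> future q)"
| "future (And p q) = (future p \<and> future q)"
| "future (Neg p) = future p"
| "future (Until L p q) = (future p \<and> future q)"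
| "future (Since L p q) = False"

definition lang_of :: "'a ltlp \<Rightarrow> 'a list set" where
  "lang_of \<phi> = {w. sat w 0 \<phi>}"

definition LTLP :: "('a::finite) list set set \<Rightarrow> 'a list set set" where
  "LTLP C = {lang_of \<phi> | \<phi>. mlangs \<phi> \<subseteq> C}"

definition LTL :: "('a::finite) list set set \<Rightarrow> 'a list set set" where
  "LTL C = {lang_of \<phi> | \<phi>. mlangs \<phi> \<subseteq> C \<and> future \<phi>}"

end

theory Submission
  imports Defs
begin

text \<open>
  For \<open>LTLP(C) \<subseteq> SF(C)\<close>, one shows by induction on a formula that its truth at a position depends only
  on the label and on the classes of the prefix and of the suffix, for a finite-index congruence all of
  whose classes lie in \<open>SF(C)\<close>.

  For \<open>SF(C) \<subseteq> LTL(C)\<close>, a language \<open>K\<close> of \<open>SF(C)\<close> comes with a finite-index congruence \<open>\<sim>\<close> whose classes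
  lie in \<open>C\<close> such that every word \<open>x \<sim> xx\<close> acts aperiodically on the left quotients of \<open>K\<close>. Following
  Wilke's proof for counter-free automata, one defines the words that send a state \<open>p\<close> to a state \<open>q\<close> by
  induction on the number of states and the number of letters. If all letters permute the states, then
  the class of a word modulo \<open>\<sim>\<close> determines its action. Otherwise some letter \<open>c\<close> acts non-injectively;
  words are cut after each \<open>c\<close>, the blocks become the letters of a new alphabet, and these act on the
  smaller set of states reached by \<open>c\<close>.
\<close>

section \<open>Quotients and finite-index congruences\<close>

text \<open>Full aperiodicity cannot be expected, since \<open>C\<close> itself may contain group
  languages. What survives is pumping for the words \<open>x\<close> that a congruence with classes
  in \<open>C\<close> cannot tell from \<open>x @ x\<close>. This suffices in the group case: a
  permutation that pumps is the identity, so congruent permutations agree, and the classes in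
  \<open>C\<close> supply the group information that star-free operations alone could not. Two
  obstacles shape the other case. Future formulas see only suffixes, so what is defined is a set of
  suffixes, and relativizing a formula to the part before the next \<open>c\<close> needs an
  explicit guard. And replacing blocks by letters must not change the meaning of a modality with
  \<open>L \<in> C\<close>: hence letters are words, \<open>L\<close> is tested on their
  concatenation, and the representative of a block keeps both its class and its action on the
  states. The block alphabet may be larger than the old one, but the state set shrinks strictly,
  which decides the order of the two inductions.\<close>

lemma lquot_append: "lquot (u @ v) L = lquot v (lquot u L)"
  by (auto simp: lquot_def)

lemma lquot_Nil [simp]: "lquot [] L = L"
  by (auto simp: lquot_def)

text \<open>The cut between the two factors falls either after \<open>u\<close> or inside it. In the
  second case a beginning of \<open>u\<close> is the whole factor from \<open>L\<close>.\<close>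

lemma lquot_conc:
  "lquot u (conc L K) = conc (lquot u L) K \<union> \<Union> ((\<lambda>v. lquot v K) ` {v. \<exists>u'\<in>L. u = u' @ v})"
  (is "?l = ?r")
proof (intro set_eqI iffI)
  fix w assume "w \<in> ?l"
  then obtain p q where pq: "u @ w = p @ q" "p \<in> L" "q \<in> K"
    by (auto simp: lquot_def conc_def)
  from pq(1) consider t where "p = u @ t" "w = t @ q" | t where "u = p @ t" "q = t @ w"
    by (auto simp: append_eq_append_conv2)
  then show "w \<in> ?r"
  proof cases
    case 1
    then show ?thesis using pq by (auto simp: lquot_def conc_def)
  next
    case 2
    then show ?thesis using pq by (auto simp: lquot_def conc_def)
  qed
next
  fix w assume "w \<in> ?r"
  then show "w \<in> ?l"
    by (auto simp: lquot_def conc_def) (metis append.assoc)+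
qed

lemma rquot_conc:
  "rquot (conc L K) u = conc L (rquot K u) \<union> \<Union> ((\<lambda>v. rquot L v) ` {v. \<exists>u'\<in>K. u = v @ u'})"
  (is "?l = ?r")
proof (intro set_eqI iffI)
  fix w assume "w \<in> ?l"
  then obtain p q where pq: "w @ u = p @ q" "p \<in> L" "q \<in> K"
    by (auto simp: rquot_def conc_def)
  from pq(1) consider t where "p = w @ t" "u = t @ q" | t where "w = p @ t" "q = t @ u"
    by (auto simp: append_eq_append_conv2)
  then show "w \<in> ?r"
  proof cases
    case 1
    then show ?thesis using pq by (auto simp: rquot_def conc_def)
  next
    case 2
    then show ?thesis using pq by (auto simp: rquot_def conc_def)
  qed
next
  fix w assume "w \<in> ?r"
  then show "w \<in> ?l"
    by (auto simp: rquot_def conc_def) (metis append.assoc)+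
qed

lemma kstar_append: "u \<in> kstar L \<Longrightarrow> v \<in> kstar L \<Longrightarrow> u @ v \<in> kstar L"
  by (induction rule: kstar.induct) (auto intro: kstar.intros)

text \<open>Singles out the factor that straddles the end of \<open>u\<close>; \<open>v\<close> is
  its part inside \<open>u\<close>. For \<open>u = []\<close> no factor has been entered, and the
  right side could miss the empty word.\<close>

lemma lquot_kstar:
  assumes "u \<noteq> []"
  shows "lquot u (kstar L) =
    \<Union> ((\<lambda>v. conc (lquot v L) (kstar L)) ` {v. \<exists>u'\<in>kstar L. u = u' @ v})" (is "?l = ?r")
proof (intro set_eqI iffI)
  fix w assume "w \<in> ?l"
  then have "u @ w \<in> kstar L" by (simp add: lquot_def)
  then have "\<exists>u' v. u = u' @ v \<and> u' \<in> kstar L \<and> w \<in> conc (lquot v L) (kstar L)"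
    using assms
  proof (induction "u @ w" arbitrary: u rule: kstar.induct)
    case kstar_nil
    then show ?case by simp
  next
    case (kstar_app l k)
    from kstar_app.hyps(4) consider t where "l = u @ t" "w = t @ k" | t where "u = l @ t" "k = t @ w"
      by (auto simp: append_eq_append_conv2)
    then show ?case
    proof cases
      case 1
      then have "u = [] @ u \<and> [] \<in> kstar L \<and> w \<in> conc (lquot u L) (kstar L)"
        using kstar_app.hyps by (auto simp: conc_def lquot_def intro: kstar.intros)
      then show ?thesis by blast
    next
      case 2
      show ?thesis
      proof (cases "t = []")
        case True
        \<comment> \<open>If \<open>u\<close> ends exactly with a factor, that factor counts as the
          straddling one, with nothing left over.\<close>
        then have "[] \<in> lquot u L" "w \<in> kstar L" using 2 kstar_app.hyps by (auto simp: lquot_def)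
        then have "w \<in> conc (lquot u L) (kstar L)"
          unfolding conc_def by (metis (mono_tags, lifting) CollectI append_Nil)
        then show ?thesis using kstar_nil[of L] by (metis append_Nil)
      next
        case False
        then obtain u' v where "t = u' @ v" "u' \<in> kstar L" "w \<in> conc (lquot v L) (kstar L)"
          using kstar_app.hyps(3)[of t] 2 by blast
        then show ?thesis using 2 kstar_app.hyps(1)
          by (metis append.assoc kstar.kstar_app)
      qed
    qed
  qed
  then show "w \<in> ?r" by auto
next
  fix w assume "w \<in> ?r"
  then obtain v u' s t where *: "u' \<in> kstar L" "u = u' @ v" "w = s @ t" "v @ s \<in> L" "t \<in> kstar L"
    by (auto simp: conc_def lquot_def)
  have "(v @ s) @ t \<in> kstar L" using * by (intro kstar.kstar_app)
  then have "u' @ (v @ s) @ t \<in> kstar L" using *(1) by (rule kstar_append[rotated])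
  then show "w \<in> ?l" using * by (simp add: lquot_def)
qed

section \<open>Languages with finitely many left quotients\<close>

definition finite_index :: "'a list set \<Rightarrow> bool" where
  "finite_index L \<longleftrightarrow> finite (range (\<lambda>u. lquot u L))"

lemma finite_index_union:
  assumes "finite_index L" "finite_index K"
  shows "finite_index (L \<union> K)"
proof -
  have "range (\<lambda>u. lquot u (L \<union> K)) \<subseteq>
      (\<lambda>(P, Q). P \<union> Q) ` (range (\<lambda>u. lquot u L) \<times> range (\<lambda>u. lquot u K))"
  proof (rule image_subsetI)
    fix u
    have "lquot u (L \<union> K) = lquot u L \<union> lquot u K" by (auto simp: lquot_def)
    then show "lquot u (L \<union> K) \<in>
        (\<lambda>(P, Q). P \<union> Q) ` (range (\<lambda>u. lquot u L) \<times> range (\<lambda>u. lquot u K))"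
      by (intro image_eqI[of _ _ "(lquot u L, lquot u K)"]) auto
  qed
  then show ?thesis
    using assms unfolding finite_index_def by (meson finite_SigmaI finite_imageI finite_subset)
qed

lemma finite_index_compl:
  assumes "finite_index L"
  shows "finite_index (- L)"
proof -
  have "range (\<lambda>u. lquot u (- L)) \<subseteq> uminus ` range (\<lambda>u. lquot u L)"
  proof (rule image_subsetI)
    fix u
    have "lquot u (- L) = - lquot u L" by (auto simp: lquot_def)
    then show "lquot u (- L) \<in> uminus ` range (\<lambda>u. lquot u L)" by simp
  qed
  then show ?thesis
    using assms unfolding finite_index_def by (meson finite_imageI finite_subset)
qed

text \<open>The subset construction: a quotient of the product is computed from one quotient of
  \<open>L\<close> and a set of quotients of \<open>K\<close>.\<close>

lemma finite_index_conc:
  assumes "finite_index L" "finite_index K"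
  shows "finite_index (conc L K)"
proof -
  have "range (\<lambda>u. lquot u (conc L K)) \<subseteq>
      (\<lambda>(P, Q). conc P K \<union> \<Union> Q) ` (range (\<lambda>u. lquot u L) \<times> Pow (range (\<lambda>u. lquot u K)))"
  proof (rule image_subsetI)
    fix u
    show "lquot u (conc L K) \<in>
        (\<lambda>(P, Q). conc P K \<union> \<Union> Q) ` (range (\<lambda>u. lquot u L) \<times> Pow (range (\<lambda>u. lquot u K)))"
      unfolding lquot_conc
      by (intro image_eqI[of _ _ "(lquot u L, (\<lambda>v. lquot v K) ` {v. \<exists>u'\<in>L. u = u' @ v})"]) auto
  qed
  then show ?thesis
    using assms unfolding finite_index_def
    by (meson finite_Pow_iff finite_SigmaI finite_imageI finite_subset)
qed

lemma finite_index_kstar: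
  assumes "finite_index L"
  shows "finite_index (kstar L)"
proof -
  have "range (\<lambda>u. lquot u (kstar L)) \<subseteq> insert (kstar L)
      ((\<lambda>Q. \<Union> ((\<lambda>P. conc P (kstar L)) ` Q)) ` Pow (range (\<lambda>u. lquot u L)))"
  proof (rule image_subsetI)
    fix u
    show "lquot u (kstar L) \<in> insert (kstar L)
      ((\<lambda>Q. \<Union> ((\<lambda>P. conc P (kstar L)) ` Q)) ` Pow (range (\<lambda>u. lquot u L)))"
    proof (cases "u = []")
      case False
      have "lquot u (kstar L) = \<Union> ((\<lambda>P. conc P (kstar L)) `
          ((\<lambda>v. lquot v L) ` {v. \<exists>u'\<in>kstar L. u = u' @ v}))"
        by (simp add: lquot_kstar[OF False] image_image)
      then show ?thesis by blast
    qed simp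
  qed
  then show ?thesis
    using assms unfolding finite_index_def
    by (meson finite_Pow_iff finite_imageI finite_insert finite_subset)
qed

lemma finite_index_finite:
  assumes "finite L"
  shows "finite_index L"
proof -
  have "range (\<lambda>u. lquot u L) \<subseteq> Pow (\<Union>w\<in>L. (\<lambda>n. drop n w) ` {..length w})"
  proof (clarsimp simp: lquot_def)
    fix u v assume "u @ v \<in> L"
    then show "\<exists>w\<in>L. v \<in> (\<lambda>n. drop n w) ` {..length w}"
      by (intro bexI[of _ "u @ v"]) (auto intro!: image_eqI[of _ _ "length u"])
  qed
  moreover have "finite (Pow (\<Union>w\<in>L. (\<lambda>n. drop n w) ` {..length w}))"
    using assms by simp
  ultimately show ?thesis unfolding finite_index_def by (rule finite_subset)
qed

lemma regular_finite_index: "regular L \<Longrightarrow> finite_index L"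
  by (induction rule: regular.induct)
    (auto intro: finite_index_finite finite_index_union finite_index_conc finite_index_kstar)

text \<open>Membership of \<open>x @ w @ y\<close> in \<open>L\<close> says that \<open>y\<close>
  lies in a left quotient of \<open>lquot x L\<close>. So a two-sided quotient is fixed by
  \<open>lquot x L\<close> and by the set of left quotients containing \<open>y\<close>.\<close>

lemma finite_index_two_sided:
  assumes "finite_index L"
  shows "finite (range (\<lambda>(x, y). lquot x (rquot L y)))"
proof -
  let ?Q = "range (\<lambda>u. lquot u L)"
  have "range (\<lambda>(x, y). lquot x (rquot L y)) \<subseteq> (\<lambda>(K, S). {w. lquot w K \<in> S}) ` (?Q \<times> Pow ?Q)"
  proof clarify
    fix x y
    have "lquot x (rquot L y) = {w. lquot w (lquot x L) \<in> {K \<in> ?Q. y \<in> K}}"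
      unfolding lquot_append[symmetric] by (simp add: lquot_def[of _ "rquot _ _"] rquot_def) (simp add: lquot_def)
    then show "lquot x (rquot L y) \<in> (\<lambda>(K, S). {w. lquot w K \<in> S}) ` (?Q \<times> Pow ?Q)"
      by (intro image_eqI[of _ _ "(lquot x L, {K \<in> ?Q. y \<in> K})"]) auto
  qed
  then show ?thesis
    using assms unfolding finite_index_def
    by (meson finite_Pow_iff finite_SigmaI finite_imageI finite_subset)
qed

text \<open>What the congruence constructions use, with regularity in its Myhill-Nerode form;
  \<open>C\<close> and \<open>SF C\<close> are both instances, so each construction serves both
  inclusions.\<close>

definition quotient_algebra :: "'a list set set \<Rightarrow> bool" where
  "quotient_algebra D \<longleftrightarrow> {} \<in> D \<and> (\<forall>L\<in>D. \<forall>K\<in>D. L \<union> K \<in> D) \<and> (\<forall>L\<in>D. - L \<in> D) \<and>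
    (\<forall>L\<in>D. \<forall>u. lquot u L \<in> D) \<and> (\<forall>L\<in>D. \<forall>u. rquot L u \<in> D) \<and> (\<forall>L\<in>D. finite_index L)"

lemma prevariety_quotient_algebra: "prevariety C \<Longrightarrow> quotient_algebra C"
  unfolding prevariety_def quotient_algebra_def by (auto intro: regular_finite_index)

lemma quotient_algebra_Union:
  assumes "quotient_algebra D" "finite F" "F \<subseteq> D"
  shows "\<Union> F \<in> D"
  using assms(2,3) by induction (use assms(1) in \<open>auto simp: quotient_algebra_def\<close>)

lemma quotient_algebra_inter:
  assumes "quotient_algebra D" "L \<in> D" "K \<in> D"
  shows "L \<inter> K \<in> D"
proof -
  have "L \<inter> K = - (- L \<union> - K)" by blast
  then show ?thesis using assms unfolding quotient_algebra_def by metis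
qed

lemma quotient_algebra_UNIV: "quotient_algebra D \<Longrightarrow> UNIV \<in> D"
  unfolding quotient_algebra_def by (metis Compl_empty_eq)

lemma quotient_algebra_Inter:
  assumes "quotient_algebra D" "finite F" "F \<subseteq> D"
  shows "\<Inter> F \<in> D"
  using assms(2,3)
  by induction (use assms(1) in \<open>auto intro: quotient_algebra_inter quotient_algebra_UNIV\<close>)

section \<open>Finite-index congruences and the languages they saturate\<close>

definition saturated :: "('a list \<Rightarrow> 'a list \<Rightarrow> bool) \<Rightarrow> 'a list set \<Rightarrow> bool" where
  "saturated R L \<longleftrightarrow> (\<forall>u v. R u v \<longrightarrow> u \<in> L \<longrightarrow> v \<in> L)"

text \<open>The kernel of a morphism onto a finite monoid whose fibres all lie in \<open>D\<close>,
  given as a relation so that no type of monoids is involved.\<close>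

definition fin_cong :: "'a list set set \<Rightarrow> ('a list \<Rightarrow> 'a list \<Rightarrow> bool) \<Rightarrow> bool" where
  "fin_cong D R \<longleftrightarrow> equivp R \<and> (\<forall>u u' v v'. R u u' \<longrightarrow> R v v' \<longrightarrow> R (u @ v) (u' @ v')) \<and>
    finite (range (\<lambda>u. {v. R u v})) \<and> (\<forall>u. {v. R u v} \<in> D)"

lemma
  assumes "fin_cong D R"
  shows fin_cong_refl: "R u u"
    and fin_cong_sym: "R u v \<Longrightarrow> R v u"
    and fin_cong_trans: "R u v \<Longrightarrow> R v w \<Longrightarrow> R u w"
    and fin_cong_append: "R u u' \<Longrightarrow> R v v' \<Longrightarrow> R (u @ v) (u' @ v')"
  using assms unfolding fin_cong_def
  by (blast intro: equivp_reflp, metis equivp_symp, metis equivp_transp, blast)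

lemma
  assumes "fin_cong D R"
  shows fin_cong_finite: "finite ((\<lambda>u. {v. R u v}) ` L)"
    and fin_cong_class_mem: "{v. R u v} \<in> D"
  using assms unfolding fin_cong_def by (metis finite_subset image_mono subset_UNIV, metis)

lemma saturated_iff:
  assumes "fin_cong D R" "saturated R L" "R u v"
  shows "u \<in> L \<longleftrightarrow> v \<in> L"
  using assms(2,3) fin_cong_sym[OF assms(1,3)] unfolding saturated_def by blast

lemma fin_cong_saturated_mem:
  assumes "quotient_algebra D" "fin_cong D R" "saturated R L"
  shows "L \<in> D"
proof -
  have "L = \<Union> ((\<lambda>u. {v. R u v}) ` L)"
    using assms(3) fin_cong_refl[OF assms(2)] unfolding saturated_def by blast
  moreover have "\<Union> ((\<lambda>u. {v. R u v}) ` L) \<in> D"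
    by (rule quotient_algebra_Union[OF assms(1) fin_cong_finite[OF assms(2)]])
      (blast intro: fin_cong_class_mem[OF assms(2)])
  ultimately show ?thesis by simp
qed

lemma fin_cong_inf:
  assumes "quotient_algebra D" "fin_cong D R" "fin_cong D S"
  shows "fin_cong D (\<lambda>u v. R u v \<and> S u v)"
  unfolding fin_cong_def
proof (intro conjI allI impI)
  show "equivp (\<lambda>u v. R u v \<and> S u v)"
  proof (intro equivpI reflpI sympI transpI)
    fix u v w assume "R u v \<and> S u v" "R v w \<and> S v w"
    then show "R u w \<and> S u w"
      using fin_cong_trans[OF assms(2)] fin_cong_trans[OF assms(3)] by metis
  qed (simp_all add: fin_cong_refl[OF assms(2)] fin_cong_refl[OF assms(3)]
      fin_cong_sym[OF assms(2)] fin_cong_sym[OF assms(3)])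
  have "range (\<lambda>u. {v. R u v \<and> S u v}) \<subseteq>
      (\<lambda>(P, Q). P \<inter> Q) ` (range (\<lambda>u. {v. R u v}) \<times> range (\<lambda>u. {v. S u v}))"
  proof (rule image_subsetI)
    fix u
    show "{v. R u v \<and> S u v} \<in>
        (\<lambda>(P, Q). P \<inter> Q) ` (range (\<lambda>u. {v. R u v}) \<times> range (\<lambda>u. {v. S u v}))"
      by (rule image_eqI[of _ _ "({v. R u v}, {v. S u v})"]) auto
  qed
  then show "finite (range (\<lambda>u. {v. R u v \<and> S u v}))"
    by (rule finite_subset)
      (intro finite_imageI finite_SigmaI fin_cong_finite[OF assms(2)] fin_cong_finite[OF assms(3)])
  show "{v. R u v \<and> S u v} \<in> D" for u
    unfolding Collect_conj_eq
    by (intro quotient_algebra_inter assms fin_cong_class_mem[OF assms(2)]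
        fin_cong_class_mem[OF assms(3)])
qed (simp_all add: fin_cong_append[OF assms(2)] fin_cong_append[OF assms(3)])

text \<open>\<open>R\<close> is the syntactic congruence of \<open>L\<close>, written as agreement
  on the finite set \<open>F\<close> of two-sided quotients; each class is therefore a finite
  Boolean combination of members of \<open>D\<close>.\<close>

lemma fin_cong_exists:
  assumes D: "quotient_algebra D" and L: "L \<in> D"
  shows "\<exists>R. fin_cong D R \<and> saturated R L"
proof -
  define F where "F = range (\<lambda>(x, y). lquot x (rquot L y))"
  define R where "R u v \<longleftrightarrow> (\<forall>B\<in>F. u \<in> B \<longleftrightarrow> v \<in> B)" for u v
  have finF: "finite F"
    unfolding F_def using D L by (intro finite_index_two_sided) (simp add: quotient_algebra_def)
  have FD: "F \<subseteq> D"
    using D L by (auto simp: F_def quotient_algebra_def)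
  have R_iff: "R u v \<longleftrightarrow> (\<forall>x y. x @ u @ y \<in> L \<longleftrightarrow> x @ v @ y \<in> L)" for u v
    by (auto simp: R_def F_def lquot_def rquot_def)
  have "equivp R"
    by (intro equivpI) (auto simp: R_def reflp_def symp_def transp_def)
  moreover have "R (u @ v) (u' @ v')" if "R u u'" "R v v'" for u u' v v'
    unfolding R_iff
  proof (intro allI)
    fix x y
    have "x @ (u @ v) @ y \<in> L \<longleftrightarrow> x @ u' @ v @ y \<in> L"
      using that(1) unfolding R_iff by (metis append.assoc)
    also have "\<dots> \<longleftrightarrow> (x @ u') @ v' @ y \<in> L"
      using that(2) unfolding R_iff by (metis append.assoc)
    finally show "x @ (u @ v) @ y \<in> L \<longleftrightarrow> x @ (u' @ v') @ y \<in> L" by simp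
  qed
  moreover have cls: "{v. R u v} = \<Inter> ({B \<in> F. u \<in> B} \<union> uminus ` {B \<in> F. u \<notin> B})" for u
    by (auto simp: R_def)
  have "finite (range (\<lambda>u. {v. R u v}))"
  proof (rule finite_subset)
    show "range (\<lambda>u. {v. R u v}) \<subseteq> (\<lambda>G. \<Inter> (G \<union> uminus ` (F - G))) ` Pow F"
    proof clarify
      fix u
      have "F - {B \<in> F. u \<in> B} = {B \<in> F. u \<notin> B}" by blast
      then show "{v. R u v} \<in> (\<lambda>G. \<Inter> (G \<union> uminus ` (F - G))) ` Pow F"
        unfolding cls by (intro image_eqI[of _ _ "{B \<in> F. u \<in> B}"]) auto
    qed
  qed (use finF in simp)
  moreover have "{v. R u v} \<in> D" for u
    unfolding cls using finF FD D
    by (intro quotient_algebra_Inter[OF D]) (auto simp: quotient_algebra_def)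
  moreover have "saturated R L"
    unfolding saturated_def R_iff by (metis append_Nil append_Nil2)
  ultimately show ?thesis unfolding fin_cong_def by blast
qed

lemma fin_cong_exists_finite:
  assumes D: "quotient_algebra D" and "finite F" "F \<subseteq> D"
  shows "\<exists>R. fin_cong D R \<and> (\<forall>L\<in>F. saturated R L)"
  using assms(2,3)
proof induction
  case empty
  have "fin_cong D (\<lambda>_ _. True)"
    unfolding fin_cong_def using quotient_algebra_UNIV[OF D]
    by (auto intro!: equivpI simp: reflp_def symp_def transp_def)
  then show ?case by blast
next
  case (insert L F)
  then obtain R where R: "fin_cong D R" "\<forall>L\<in>F. saturated R L" by auto
  obtain S where S: "fin_cong D S" "saturated S L"
    using fin_cong_exists[OF D] insert.prems by blast
  have "fin_cong D (\<lambda>u v. R u v \<and> S u v) \<and> (\<forall>L\<in>insert L F. saturated (\<lambda>u v. R u v \<and> S u v) L)"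
    using fin_cong_inf[OF D R(1) S(1)] R(2) S(2) by (auto simp: saturated_def)
  then show ?case by blast
qed

section \<open>Quotients and Boolean operations on star-free languages\<close>

lemma SF_empty: "prevariety C \<Longrightarrow> {} \<in> SF C"
  by (simp add: prevariety_def SF.SF_base)

lemma SF_UNIV: "prevariety C \<Longrightarrow> UNIV \<in> SF C"
  by (simp add: prevariety_def SF.SF_base)

lemma SF_Union:
  assumes "prevariety C" "finite F" "F \<subseteq> SF C"
  shows "\<Union> F \<in> SF C"
  using assms(2,3) by induction (auto intro: SF_empty[OF assms(1)] SF.SF_union)

lemma SF_Nil:
  fixes C :: "'a::finite list set set"
  assumes "prevariety C"
  shows "{[]} \<in> SF C"
proof -
  have "{[]} = - \<Union> (range (\<lambda>a. conc {[a :: 'a]} UNIV))"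
    by (auto simp: conc_def) (metis neq_Nil_conv)
  moreover have "\<Union> (range (\<lambda>a. conc {[a :: 'a]} UNIV)) \<in> SF C"
    by (intro SF_Union[OF assms]) (auto intro: SF.intros SF_UNIV[OF assms])
  ultimately show ?thesis using SF.SF_compl by metis
qed

lemma finite_suffix_set: "finite {v. \<exists>u'\<in>L. u = u' @ v}"
proof -
  have "{v. \<exists>u'\<in>L. u = u' @ v} \<subseteq> (\<lambda>n. drop n u) ` {..length u}"
  proof clarify
    fix u' v
    show "v \<in> (\<lambda>n. drop n (u' @ v)) ` {..length (u' @ v)}"
      by (rule image_eqI[of _ _ "length u'"]) auto
  qed
  then show ?thesis by (rule finite_subset) simp
qed

lemma finite_prefix_set: "finite {v. \<exists>u'\<in>L. u = v @ u'}"
proof -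
  have "{v. \<exists>u'\<in>L. u = v @ u'} \<subseteq> (\<lambda>n. take n u) ` {..length u}"
  proof clarify
    fix u' v
    show "v \<in> (\<lambda>n. take n (v @ u')) ` {..length (v @ u')}"
      by (rule image_eqI[of _ _ "length v"]) auto
  qed
  then show ?thesis by (rule finite_subset) simp
qed

lemma SF_lquot:
  assumes C: "prevariety C" and "L \<in> SF C"
  shows "lquot u L \<in> SF C"
  using assms(2)
proof (induction arbitrary: u rule: SF.induct)
  case (SF_base L)
  then show ?case using C unfolding prevariety_def by (blast intro: SF.SF_base)
next
  case (SF_letter a)
  consider "lquot u {[a]} = {[a]}" | "lquot u {[a]} = {[]}" | "lquot u {[a]} = {}"
    by (cases u) (auto simp: lquot_def)
  then show ?case by cases (simp_all only: SF_Nil[OF C] SF_empty[OF C] SF.SF_letter)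
next
  case (SF_union L K)
  have "lquot u (L \<union> K) = lquot u L \<union> lquot u K" by (auto simp: lquot_def)
  then show ?case using SF_union.IH by (simp add: SF.SF_union)
next
  case (SF_compl L)
  have "lquot u (- L) = - lquot u L" by (auto simp: lquot_def)
  then show ?case using SF_compl.IH by (simp add: SF.SF_compl)
next
  case (SF_conc L K)
  show ?case unfolding lquot_conc
    by (rule SF.SF_union[OF SF.SF_conc[OF SF_conc.IH(1) SF_conc.hyps(2)]
          SF_Union[OF C finite_imageI[OF finite_suffix_set]]]) (blast intro: SF_conc.IH)
qed

lemma SF_rquot:
  assumes C: "prevariety C" and "L \<in> SF C"
  shows "rquot L u \<in> SF C"
  using assms(2)
proof (induction arbitrary: u rule: SF.induct)
  case (SF_base L)
  then show ?case using C unfolding prevariety_def by (blast intro: SF.SF_base)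
next
  case (SF_letter a)
  consider "rquot {[a]} u = {[a]}" | "rquot {[a]} u = {[]}" | "rquot {[a]} u = {}"
    by (cases u) (auto simp: rquot_def append_eq_Cons_conv)
  then show ?case by cases (simp_all only: SF_Nil[OF C] SF_empty[OF C] SF.SF_letter)
next
  case (SF_union L K)
  have "rquot (L \<union> K) u = rquot L u \<union> rquot K u" by (auto simp: rquot_def)
  then show ?case using SF_union.IH by (simp add: SF.SF_union)
next
  case (SF_compl L)
  have "rquot (- L) u = - rquot L u" by (auto simp: rquot_def)
  then show ?case using SF_compl.IH by (simp add: SF.SF_compl)
next
  case (SF_conc L K)
  show ?case unfolding rquot_conc
    by (rule SF.SF_union[OF SF.SF_conc[OF SF_conc.hyps(1) SF_conc.IH(2)]
          SF_Union[OF C finite_imageI[OF finite_prefix_set]]]) (blast intro: SF_conc.IH)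
qed

lemma SF_finite_index:
  assumes C: "prevariety C" and "L \<in> SF C"
  shows "finite_index L"
  using assms(2)
proof (induction rule: SF.induct)
  case (SF_base L)
  then show ?case using C unfolding prevariety_def by (blast intro: regular_finite_index)
qed (auto intro: finite_index_finite finite_index_union finite_index_compl finite_index_conc)

lemma SF_quotient_algebra: "prevariety C \<Longrightarrow> quotient_algebra (SF C)"
  unfolding quotient_algebra_def
  by (auto intro: SF_empty SF.SF_union SF.SF_compl SF_lquot SF_rquot SF_finite_index)

text \<open>Makes unions over all factorizations finite: the indices are a letter and two arbitrary
  words, but the summand depends on the words only through their classes.\<close>

lemma fin_cong_finite_image2:
  fixes h :: "'b::finite \<Rightarrow> 'a list \<Rightarrow> 'a list \<Rightarrow> 'c"
  assumes R: "fin_cong D R" and h: "\<And>b u u' v v'. R u u' \<Longrightarrow> R v v' \<Longrightarrow> h b u v = h b u' v'"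
  shows "finite ((\<lambda>(b, u, v). h b u v) ` A)"
proof (rule finite_subset)
  let ?cl = "\<lambda>u. {v. R u v}"
  have some: "R u (SOME v. v \<in> ?cl u)" for u
    by (rule someI2[of _ u]) (auto simp: fin_cong_refl[OF R])
  show "(\<lambda>(b, u, v). h b u v) ` A \<subseteq>
      (\<lambda>(b, U, V). h b (SOME u. u \<in> U) (SOME v. v \<in> V)) ` (UNIV \<times> range ?cl \<times> range ?cl)"
  proof clarify
    fix b u v
    show "h b u v \<in> (\<lambda>(b, U, V). h b (SOME u. u \<in> U) (SOME v. v \<in> V)) ` (UNIV \<times> range ?cl \<times> range ?cl)"
      by (rule image_eqI[of _ _ "(b, ?cl u, ?cl v)"]) (use h[OF some some] in auto)
  qed
  show "finite ((\<lambda>(b, U, V). h b (SOME u. u \<in> U) (SOME v. v \<in> V)) ` (UNIV \<times> range ?cl \<times> range ?cl))"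
    by (intro finite_imageI finite_SigmaI fin_cong_finite[OF R] finite)
qed

lemma fin_cong_finite_image:
  assumes R: "fin_cong D R" and h: "\<And>u u'. R u u' \<Longrightarrow> h u = h u'"
  shows "finite (h ` A)"
proof -
  have "finite ((\<lambda>(b :: bool, u, v). h u) ` ((\<lambda>u. (True, u, u)) ` A))"
    by (rule fin_cong_finite_image2[OF R]) (rule h)
  then show ?thesis by (simp add: image_image)
qed

lemma fin_cong_class_eq:
  assumes "fin_cong D R" "R u u'"
  shows "{v. R u v} = {v. R u' v}"
  using fin_cong_trans[OF assms(1)] fin_cong_sym[OF assms(1)] assms(2) by blast

section \<open>From temporal formulas to star-free expressions\<close>

text \<open>Trades positions for factorizations. Position \<open>length p\<close> is the last letter
  of \<open>p\<close>, or the unlabelled start if \<open>p\<close> is empty; the witness opens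
  \<open>t\<close>, or is the end position if \<open>t\<close> is empty.\<close>

lemma sat_Until_append:
  "sat (p @ s) (length p) (Until L f g) \<longleftrightarrow>
    (\<exists>x t. s = x @ t \<and> x \<in> L \<and> sat (p @ s) (Suc (length p + length x)) g \<and>
      (\<forall>x1 c x2. x = x1 @ c # x2 \<longrightarrow> sat (p @ s) (Suc (length p + length x1)) f))" (is "?l = ?r")
proof
  assume ?l
  then obtain j where j: "length p < j" "j \<le> length (p @ s) + 1" "infx (p @ s) (length p) j \<in> L"
    "sat (p @ s) j g" "\<And>k. length p < k \<Longrightarrow> k < j \<Longrightarrow> sat (p @ s) k f"
    by auto
  let ?x = "take (j - length p - 1) s"
  have len: "length ?x = j - length p - 1" using j(2) by simp
  have "sat (p @ s) (Suc (length p + length x1)) f" if "?x = x1 @ c # x2" for x1 c x2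
  proof (rule j(5))
    show "Suc (length p + length x1) < j"
      using arg_cong[OF that, of length] len by simp
  qed simp
  moreover have "?x \<in> L" using j(3) by (simp add: infx_def)
  moreover have "Suc (length p + length ?x) = j" using len j(1) by simp
  ultimately show ?r using j(4) by (intro exI[of _ ?x] exI[of _ "drop (j - length p - 1) s"]) simp
next
  assume ?r
  then obtain x t where x: "s = x @ t" "x \<in> L" "sat (p @ s) (Suc (length p + length x)) g"
    "\<And>x1 c x2. x = x1 @ c # x2 \<Longrightarrow> sat (p @ s) (Suc (length p + length x1)) f"
    by blast
  have "sat (p @ s) k f" if k: "length p < k" "k < Suc (length p + length x)" for k
  proof -
    let ?i = "k - length p - 1"
    have "?i < length x" using k by linarith
    then have "x = take ?i x @ x ! ?i # drop (Suc ?i) x" by (rule id_take_nth_drop)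
    then have "sat (p @ s) (Suc (length p + length (take ?i x))) f" by (rule x(4))
    then show ?thesis using k \<open>?i < length x\<close> by simp
  qed
  moreover have "infx (p @ s) (length p) (Suc (length p + length x)) = x"
    using x(1) by (simp add: infx_def)
  ultimately show ?l using x(1,2,3)
    by (auto intro!: exI[of _ "Suc (length p + length x)"])
qed

text \<open>Here the current position opens \<open>s\<close>, hence the successor, and the witness
  closes \<open>t\<close>, or is the start if \<open>t\<close> is empty.\<close>

lemma sat_Since_append:
  "sat (p @ s) (Suc (length p)) (Since L f g) \<longleftrightarrow>
    (\<exists>t x. p = t @ x \<and> x \<in> L \<and> sat (p @ s) (length t) g \<and>
      (\<forall>x1 c x2. x = x1 @ c # x2 \<longrightarrow> sat (p @ s) (Suc (length t + length x1)) f))" (is "?l = ?r")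
proof
  assume ?l
  then obtain j where j: "j < Suc (length p)" "infx (p @ s) j (Suc (length p)) \<in> L"
    "sat (p @ s) j g" "\<And>k. j < k \<Longrightarrow> k < Suc (length p) \<Longrightarrow> sat (p @ s) k f"
    by auto
  let ?x = "drop j p"
  have "sat (p @ s) (Suc (j + length x1)) f" if "?x = x1 @ c # x2" for x1 c x2
  proof (rule j(4))
    show "Suc (j + length x1) < Suc (length p)"
      using arg_cong[OF that, of length] by simp
  qed simp
  moreover have "?x \<in> L" using j(1,2) by (simp add: infx_def)
  moreover have "length (take j p) = j" using j(1) by simp
  ultimately show ?r using j(3) by (intro exI[of _ "take j p"] exI[of _ ?x]) simp
next
  assume ?r
  then obtain t x where x: "p = t @ x" "x \<in> L" "sat (p @ s) (length t) g"
    "\<And>x1 c x2. x = x1 @ c # x2 \<Longrightarrow> sat (p @ s) (Suc (length t + length x1)) f"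
    by blast
  have "sat (p @ s) k f" if k: "length t < k" "k < Suc (length p)" for k
  proof -
    let ?i = "k - length t - 1"
    have "?i < length x" using k x(1) by simp
    then have "x = take ?i x @ x ! ?i # drop (Suc ?i) x" by (rule id_take_nth_drop)
    then have "sat (p @ s) (Suc (length t + length (take ?i x))) f" by (rule x(4))
    then show ?thesis using k \<open>?i < length x\<close> by simp
  qed
  moreover have "infx (p @ s) (length t) (Suc (length p)) = x"
    using x(1) by (simp add: infx_def)
  ultimately show ?l using x(1,2,3)
    by (auto intro!: exI[of _ "length t"])
qed

text \<open>The first clause treats labelled positions. The two unlabelled ones have the whole word
  on one side, so its class alone has to decide.\<close>

definition class_determined :: "('a list \<Rightarrow> 'a list \<Rightarrow> bool) \<Rightarrow> 'a ltlp \<Rightarrow> bool" where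
  "class_determined R \<phi> \<longleftrightarrow>
    (\<forall>u u' a v v'. R u u' \<longrightarrow> R v v' \<longrightarrow>
      sat (u @ a # v) (Suc (length u)) \<phi> = sat (u' @ a # v') (Suc (length u')) \<phi>) \<and>
    (\<forall>w w'. R w w' \<longrightarrow> sat w 0 \<phi> = sat w' 0 \<phi>) \<and>
    (\<forall>w w'. R w w' \<longrightarrow> sat w (Suc (length w)) \<phi> = sat w' (Suc (length w')) \<phi>)"

lemma
  assumes "class_determined R \<phi>"
  shows class_determined_label: "R u u' \<Longrightarrow> R v v' \<Longrightarrow>
      sat (u @ a # v) (Suc (length u)) \<phi> = sat (u' @ a # v') (Suc (length u')) \<phi>"
    and class_determined_first: "R w w' \<Longrightarrow> sat w 0 \<phi> = sat w' 0 \<phi>"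
    and class_determined_last: "R w w' \<Longrightarrow> sat w (Suc (length w)) \<phi> = sat w' (Suc (length w')) \<phi>"
  using assms unfolding class_determined_def by blast+

lemma class_determined_mono:
  assumes "class_determined R \<phi>" "\<And>u v. S u v \<Longrightarrow> R u v"
  shows "class_determined S \<phi>"
  using assms unfolding class_determined_def by blast

text \<open>The infixes allowed between a position closing \<open>p\<close> and one opening
  \<open>s\<close>, for until and since alike; inner positions are evaluated in the full word
  \<open>p @ x @ s\<close>.\<close>

definition middle :: "'a ltlp \<Rightarrow> 'a list set \<Rightarrow> 'a list \<Rightarrow> 'a list \<Rightarrow> 'a list set" where
  "middle f L p s = {x \<in> L. \<forall>x1 c x2. x = x1 @ c # x2 \<longrightarrow>
    sat ((p @ x1) @ c # (x2 @ s)) (Suc (length (p @ x1))) f}"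

context
  fixes C :: "'a::finite list set set" and R f g L
  assumes C: "prevariety C" and R: "fin_cong (SF C) R"
    and f: "class_determined R f" and g: "class_determined R g" and L: "L \<in> SF C"
begin

lemma middle_cong:
  assumes "R p p'" "R s s'"
  shows "middle f L p s = middle f L p' s'"
proof -
  have "sat ((p @ x1) @ c # (x2 @ s)) (Suc (length (p @ x1))) f =
        sat ((p' @ x1) @ c # (x2 @ s')) (Suc (length (p' @ x1))) f" for x1 c x2
    by (intro class_determined_label[OF f] fin_cong_append[OF R] assms fin_cong_refl[OF R])
  then show ?thesis unfolding middle_def by blast
qed

text \<open>The condition on inner positions forbids certain factorizations
  \<open>x1 @ c # x2\<close>. Whether one is forbidden depends only on \<open>c\<close> and two
  classes, so the forbidden words form a finite union of products of a class, a letter and a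
  class.\<close>

lemma middle_mem: "middle f L p s \<in> SF C"
proof -
  let ?bad = "{(c, x1, x2). \<not> sat ((p @ x1) @ c # (x2 @ s)) (Suc (length (p @ x1))) f}"
  let ?h = "\<lambda>c x1 x2. conc {v. R x1 v} (conc {[c :: 'a]} {v. R x2 v})"
  have iff: "sat ((p @ x1) @ c # (x2 @ s)) (Suc (length (p @ x1))) f =
        sat ((p @ y1) @ c # (y2 @ s)) (Suc (length (p @ y1))) f" if "R x1 y1" "R x2 y2" for x1 x2 y1 y2 c
    by (intro class_determined_label[OF f] fin_cong_append[OF R] that fin_cong_refl[OF R])
  have mem: "\<Union> ((\<lambda>(c, x1, x2). ?h c x1 x2) ` ?bad) \<in> SF C"
  proof (rule SF_Union[OF C])
    show "finite ((\<lambda>(c, x1, x2). ?h c x1 x2) ` ?bad)"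
      by (rule fin_cong_finite_image2[OF R]) (simp add: fin_cong_class_eq[OF R])
    show "(\<lambda>(c, x1, x2). ?h c x1 x2) ` ?bad \<subseteq> SF C"
      by (auto intro!: SF.SF_conc SF.SF_letter fin_cong_class_mem[OF R])
  qed
  have "middle f L p s = L \<inter> - \<Union> ((\<lambda>(c, x1, x2). ?h c x1 x2) ` ?bad)"
  proof (intro equalityI subsetI IntI ComplI)
    fix x assume x: "x \<in> middle f L p s" and "x \<in> \<Union> ((\<lambda>(c, x1, x2). ?h c x1 x2) ` ?bad)"
    then obtain c x1 x2 where bad: "(c, x1, x2) \<in> ?bad" and "x \<in> ?h c x1 x2" by blast
    then obtain y1 y2 where y: "x = y1 @ c # y2" "R x1 y1" "R x2 y2" by (auto simp: conc_def)
    have "sat ((p @ y1) @ c # (y2 @ s)) (Suc (length (p @ y1))) f"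
      using x y(1) unfolding middle_def by blast
    then show False using iff[OF y(2,3)] bad by simp
  next
    fix x assume x: "x \<in> L \<inter> - \<Union> ((\<lambda>(c, x1, x2). ?h c x1 x2) ` ?bad)"
    show "x \<in> middle f L p s" unfolding middle_def
    proof (clarify, intro conjI allI impI)
      show "x \<in> L" using x by blast
      fix x1 c x2 assume eq: "x = x1 @ c # x2"
      have "[c] @ x2 \<in> conc {[c]} {v. R x2 v}"
        unfolding conc_def using fin_cong_refl[OF R] by blast
      then have "x1 @ [c] @ x2 \<in> ?h c x1 x2"
        unfolding conc_def[of "{v. R x1 v}"] using fin_cong_refl[OF R] by blast
      then have "x \<in> ?h c x1 x2" unfolding eq by simp
      then have "(c, x1, x2) \<notin> ?bad" using x by blast
      then show "sat ((p @ x1) @ c # (x2 @ s)) (Suc (length (p @ x1))) f" by simp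
    qed
  qed (simp add: middle_def)
  then show ?thesis
    using quotient_algebra_inter[OF SF_quotient_algebra[OF C] L SF.SF_compl[OF mem]] by simp
qed

text \<open>Separates the end position from a labelled witness, because
  \<open>class_determined\<close> speaks about them in different clauses.\<close>

lemma sat_Until_middle:
  "sat (p @ s) (length p) (Until L f g) \<longleftrightarrow>
    (s \<in> middle f L p [] \<and> sat (p @ s) (Suc (length (p @ s))) g) \<or>
    (\<exists>x b y. s = x @ b # y \<and> x \<in> middle f L p (b # y) \<and>
      sat ((p @ x) @ b # y) (Suc (length (p @ x))) g)" (is "?l \<longleftrightarrow> ?r")
proof
  assume ?l
  then obtain x t where x: "s = x @ t" "x \<in> L" "sat (p @ s) (Suc (length p + length x)) g"
    "\<And>x1 c x2. x = x1 @ c # x2 \<Longrightarrow> sat (p @ s) (Suc (length p + length x1)) f"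
    unfolding sat_Until_append by blast
  then have "x \<in> middle f L p t" by (auto simp: middle_def)
  then show ?r using x by (cases t) auto
next
  assume ?r
  then obtain x t where x: "s = x @ t" "x \<in> middle f L p t" "sat (p @ s) (Suc (length p + length x)) g"
  proof (elim disjE exE conjE)
    fix x b y assume "s = x @ b # y" "x \<in> middle f L p (b # y)"
      "sat ((p @ x) @ b # y) (Suc (length (p @ x))) g"
    then show thesis by (intro that[of x "b # y"]) auto
  qed (auto intro: that[of s "[]"])
  then have "\<forall>x1 c x2. x = x1 @ c # x2 \<longrightarrow> sat (p @ s) (Suc (length p + length x1)) f" "x \<in> L"
    by (auto simp: middle_def)
  then show ?l unfolding sat_Until_append using x by blast
qed

lemma sat_Since_middle:
  "sat (p @ s) (Suc (length p)) (Since L f g) \<longleftrightarrow>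
    (p \<in> middle f L [] s \<and> sat (p @ s) 0 g) \<or>
    (\<exists>y b x. p = y @ b # x \<and> x \<in> middle f L (y @ [b]) s \<and>
      sat (y @ b # (x @ s)) (Suc (length y)) g)" (is "?l \<longleftrightarrow> ?r")
proof
  assume ?l
  then obtain t x where x: "p = t @ x" "x \<in> L" "sat (p @ s) (length t) g"
    "\<And>x1 c x2. x = x1 @ c # x2 \<Longrightarrow> sat (p @ s) (Suc (length t + length x1)) f"
    unfolding sat_Since_append by blast
  then have "x \<in> middle f L t s" by (auto simp: middle_def)
  then show ?r using x by (cases t rule: rev_cases) auto
next
  assume ?r
  then obtain t x where x: "p = t @ x" "x \<in> middle f L t s" "sat (p @ s) (length t) g"
  proof (elim disjE exE conjE)
    fix y b x assume "p = y @ b # x" "x \<in> middle f L (y @ [b]) s"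
      "sat (y @ b # (x @ s)) (Suc (length y)) g"
    then show thesis by (intro that[of "y @ [b]" x]) auto
  qed (auto intro: that[of "[]" p])
  then have "\<forall>x1 c x2. x = x1 @ c # x2 \<longrightarrow> sat (p @ s) (Suc (length t + length x1)) f" "x \<in> L"
    by (auto simp: middle_def)
  then show ?l unfolding sat_Since_append using x by blast
qed

lemma Until_prefix_cong:
  assumes "R p p'"
  shows "sat (p @ s) (length p) (Until L f g) \<longleftrightarrow> sat (p' @ s) (length p') (Until L f g)"
proof -
  have "sat (p @ s) (Suc (length (p @ s))) g = sat (p' @ s) (Suc (length (p' @ s))) g"
    by (intro class_determined_last[OF g] fin_cong_append[OF R] assms fin_cong_refl[OF R])
  moreover have "sat ((p @ x) @ b # y) (Suc (length (p @ x))) g =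
      sat ((p' @ x) @ b # y) (Suc (length (p' @ x))) g" for x b y
    by (intro class_determined_label[OF g] fin_cong_append[OF R] assms fin_cong_refl[OF R])
  ultimately show ?thesis
    unfolding sat_Until_middle using middle_cong[OF assms fin_cong_refl[OF R]] by simp
qed

lemma Since_suffix_cong:
  assumes "R s s'"
  shows "sat (p @ s) (Suc (length p)) (Since L f g) \<longleftrightarrow> sat (p @ s') (Suc (length p)) (Since L f g)"
proof -
  have "sat (p @ s) 0 g = sat (p @ s') 0 g"
    by (intro class_determined_first[OF g] fin_cong_append[OF R] assms fin_cong_refl[OF R])
  moreover have "sat (y @ b # (x @ s)) (Suc (length y)) g =
      sat (y @ b # (x @ s')) (Suc (length y)) g" for x b y
    by (intro class_determined_label[OF g] fin_cong_append[OF R] assms fin_cong_refl[OF R])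
  ultimately show ?thesis
    unfolding sat_Since_middle using middle_cong[OF fin_cong_refl[OF R] assms] by simp
qed

text \<open>For a labelled witness \<open>b\<close>, the words \<open>x\<close> and \<open>y\<close>
  around it matter only through their classes, and so does the set
  \<open>middle f L p (b # y)\<close>. The union over all good triples is thus finite; intersecting
  with the class of \<open>x\<close> keeps \<open>g\<close> true at the witness.\<close>

lemma Until_suffixes_mem: "{s. sat (p @ s) (length p) (Until L f g)} \<in> SF C"
proof -
  let ?good = "{(b, x, y). sat ((p @ x) @ b # y) (Suc (length (p @ x))) g}"
  let ?h = "\<lambda>b x y. conc (middle f L p (b # y) \<inter> {v. R x v}) (conc {[b :: 'a]} {v. R y v})"
  let ?last = "{s. sat (p @ s) (Suc (length (p @ s))) g}"
  note inter = quotient_algebra_inter[OF SF_quotient_algebra[OF C]]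
  have Cons: "R (b # y) (b # y')" if "R y y'" for b y y'
    using fin_cong_append[OF R fin_cong_refl[OF R] that, of "[b]"] by simp
  have iff: "sat ((p @ x) @ b # y) (Suc (length (p @ x))) g =
      sat ((p @ x') @ b # y') (Suc (length (p @ x'))) g" if "R x x'" "R y y'" for x x' y y' b
    by (intro class_determined_label[OF g] fin_cong_append[OF R] that fin_cong_refl[OF R])
  have "saturated R ?last"
    unfolding saturated_def
    using class_determined_last[OF g fin_cong_append[OF R fin_cong_refl[OF R]]] by blast
  then have last: "?last \<in> SF C"
    by (rule fin_cong_saturated_mem[OF SF_quotient_algebra[OF C] R])
  have mem: "\<Union> ((\<lambda>(b, x, y). ?h b x y) ` ?good) \<in> SF C"
  proof (rule SF_Union[OF C])
    show "finite ((\<lambda>(b, x, y). ?h b x y) ` ?good)"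
    proof (rule fin_cong_finite_image2[OF R])
      fix b u u' v v' assume "R u u'" "R v v'"
      then show "?h b u v = ?h b u' v'"
        using middle_cong[OF fin_cong_refl[OF R, of p] Cons[of v v' b]]
        by (simp add: fin_cong_class_eq[OF R])
    qed
    show "(\<lambda>(b, x, y). ?h b x y) ` ?good \<subseteq> SF C"
      by (auto intro!: SF.SF_conc SF.SF_letter inter middle_mem fin_cong_class_mem[OF R])
  qed
  have "{s. sat (p @ s) (length p) (Until L f g)} =
      (middle f L p [] \<inter> ?last) \<union> \<Union> ((\<lambda>(b, x, y). ?h b x y) ` ?good)" (is "?U = ?V \<union> ?W")
  proof (intro equalityI subsetI)
    fix s assume "s \<in> ?U"
    then consider "s \<in> ?V"
      | x b y where "s = x @ b # y" "x \<in> middle f L p (b # y)" "(b, x, y) \<in> ?good"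
      unfolding mem_Collect_eq sat_Until_middle by blast
    then show "s \<in> ?V \<union> ?W"
    proof cases
      case 2
      have "[b] @ y \<in> conc {[b]} {v. R y v}"
        unfolding conc_def using fin_cong_refl[OF R] by blast
      then have "x @ [b] @ y \<in> ?h b x y"
        unfolding conc_def[of "_ \<inter> _"] using 2(2) fin_cong_refl[OF R] by blast
      then have "s \<in> ?h b x y" using 2(1) by simp
      then show ?thesis using 2(3) by blast
    qed blast
  next
    fix s assume "s \<in> ?V \<union> ?W"
    then show "s \<in> ?U"
    proof
      assume "s \<in> ?W"
      then obtain b x y where good: "(b, x, y) \<in> ?good" and "s \<in> ?h b x y" by blast
      then obtain x' y' where s: "s = x' @ b # y'" "x' \<in> middle f L p (b # y)" "R x x'" "R y y'"
        by (auto simp: conc_def)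
      then have "x' \<in> middle f L p (b # y')"
        using middle_cong[OF fin_cong_refl[OF R, of p] Cons[OF s(4), of b]] by simp
      moreover have "sat ((p @ x') @ b # y') (Suc (length (p @ x'))) g"
        using iff[OF s(3,4)] good by simp
      ultimately show ?thesis unfolding mem_Collect_eq sat_Until_middle using s(1) by blast
    qed (unfold mem_Collect_eq sat_Until_middle, blast)
  qed
  then show ?thesis using SF.SF_union[OF inter[OF middle_mem last] mem] by simp
qed

text \<open>The mirror image: the witness lies in the prefix, and \<open>middle\<close> is anchored
  at the word \<open>y @ [b]\<close> that it closes.\<close>

lemma Since_prefixes_mem: "{p. sat (p @ s) (Suc (length p)) (Since L f g)} \<in> SF C"
proof -
  let ?good = "{(b, x, y). sat (y @ b # (x @ s)) (Suc (length y)) g}"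
  let ?h = "\<lambda>b x y. conc {v. R y v} (conc {[b :: 'a]} (middle f L (y @ [b]) s \<inter> {v. R x v}))"
  let ?first = "{p. sat (p @ s) 0 g}"
  note inter = quotient_algebra_inter[OF SF_quotient_algebra[OF C]]
  have snoc: "R (y @ [b]) (y' @ [b])" if "R y y'" for b y y'
    by (rule fin_cong_append[OF R that fin_cong_refl[OF R]])
  have iff: "sat (y @ b # (x @ s)) (Suc (length y)) g =
      sat (y' @ b # (x' @ s)) (Suc (length y')) g" if "R x x'" "R y y'" for x x' y y' b
    by (intro class_determined_label[OF g] fin_cong_append[OF R] that fin_cong_refl[OF R])
  have "saturated R ?first"
    unfolding saturated_def
    using class_determined_first[OF g fin_cong_append[OF R _ fin_cong_refl[OF R]]] by blast
  then have first: "?first \<in> SF C"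
    by (rule fin_cong_saturated_mem[OF SF_quotient_algebra[OF C] R])
  have mem: "\<Union> ((\<lambda>(b, x, y). ?h b x y) ` ?good) \<in> SF C"
  proof (rule SF_Union[OF C])
    show "finite ((\<lambda>(b, x, y). ?h b x y) ` ?good)"
    proof (rule fin_cong_finite_image2[OF R])
      fix b u u' v v' assume "R u u'" "R v v'"
      then show "?h b u v = ?h b u' v'"
        using middle_cong[OF snoc[of v v' b] fin_cong_refl[OF R, of s]]
        by (simp add: fin_cong_class_eq[OF R])
    qed
    show "(\<lambda>(b, x, y). ?h b x y) ` ?good \<subseteq> SF C"
      by (auto intro!: SF.SF_conc SF.SF_letter inter middle_mem fin_cong_class_mem[OF R])
  qed
  have "{p. sat (p @ s) (Suc (length p)) (Since L f g)} =
      (middle f L [] s \<inter> ?first) \<union> \<Union> ((\<lambda>(b, x, y). ?h b x y) ` ?good)" (is "?U = ?V \<union> ?W")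
  proof (intro equalityI subsetI)
    fix p assume "p \<in> ?U"
    then consider "p \<in> ?V"
      | x b y where "p = y @ b # x" "x \<in> middle f L (y @ [b]) s" "(b, x, y) \<in> ?good"
      unfolding mem_Collect_eq sat_Since_middle by blast
    then show "p \<in> ?V \<union> ?W"
    proof cases
      case 2
      have "[b] @ x \<in> conc {[b]} (middle f L (y @ [b]) s \<inter> {v. R x v})"
        unfolding conc_def using 2(2) fin_cong_refl[OF R] by blast
      then have "y @ [b] @ x \<in> ?h b x y"
        unfolding conc_def[of "{v. R y v}"] using fin_cong_refl[OF R] by blast
      then have "p \<in> ?h b x y" using 2(1) by simp
      then show ?thesis using 2(3) by blast
    qed blast
  next
    fix p assume "p \<in> ?V \<union> ?W"
    then show "p \<in> ?U"
    proof
      assume "p \<in> ?W"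
      then obtain b x y where good: "(b, x, y) \<in> ?good" and "p \<in> ?h b x y" by blast
      then obtain x' y' where p: "p = y' @ b # x'" "x' \<in> middle f L (y @ [b]) s" "R x x'" "R y y'"
        by (auto simp: conc_def)
      then have "x' \<in> middle f L (y' @ [b]) s"
        using middle_cong[OF snoc[OF p(4), of b] fin_cong_refl[OF R, of s]] by simp
      moreover have "sat (y' @ b # (x' @ s)) (Suc (length y')) g"
        using iff[OF p(3,4)] good by simp
      ultimately show ?thesis unfolding mem_Collect_eq sat_Since_middle using p(1) by blast
    qed (unfold mem_Collect_eq sat_Since_middle, blast)
  qed
  then show ?thesis using SF.SF_union[OF inter[OF middle_mem first] mem] by simp
qed

text \<open>The prefix matters only modulo \<open>R\<close>, so only finitely many suffix languages
  \<open>?G p\<close> arise. They are all star-free, and \<open>S\<close> is a congruence that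
  saturates them.\<close>

lemma class_determined_Until: "\<exists>S. fin_cong (SF C) S \<and> class_determined S (Until L f g)"
proof -
  let ?G = "\<lambda>p. {s. sat (p @ s) (length p) (Until L f g)}"
  have G: "?G p = ?G p'" if "R p p'" for p p'
    by (rule Collect_cong) (rule Until_prefix_cong[OF that])
  have "finite (range ?G)" by (rule fin_cong_finite_image[OF R G])
  moreover have "range ?G \<subseteq> SF C" by (rule image_subsetI) (rule Until_suffixes_mem)
  ultimately obtain S where S: "fin_cong (SF C) S" "\<forall>L\<in>range ?G. saturated S L"
    using fin_cong_exists_finite[OF SF_quotient_algebra[OF C]] by meson
  let ?T = "\<lambda>u v. R u v \<and> S u v"
  have suffix: "sat (p @ s) (length p) (Until L f g) = sat (p @ s') (length p) (Until L f g)"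
    if "S s s'" for p s s'
  proof -
    have "saturated S (?G p)" using S(2) by blast
    from saturated_iff[OF S(1) this that] show ?thesis unfolding mem_Collect_eq .
  qed
  have "class_determined ?T (Until L f g)"
    unfolding class_determined_def
  proof (intro conjI allI impI; elim conjE)
    fix u u' v v' a assume "R u u'" "S v v'"
    \<comment> \<open>For until the current letter belongs to the prefix: \<open>R\<close> controls
      \<open>u @ [a]\<close> and \<open>S\<close> controls \<open>v\<close>.\<close>
    then have "R (u @ [a]) (u' @ [a])"
      by (intro fin_cong_append[OF R] fin_cong_refl[OF R])
    then show "sat (u @ a # v) (Suc (length u)) (Until L f g) =
        sat (u' @ a # v') (Suc (length u')) (Until L f g)"
      using Until_prefix_cong[of "u @ [a]" "u' @ [a]" v] suffix[OF \<open>S v v'\<close>, of "u' @ [a]"]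
      by (simp del: sat.simps)
  next
    fix w w' assume "S w w'"
    then show "sat w 0 (Until L f g) = sat w' 0 (Until L f g)"
      using suffix[of w w' "[]"] by (simp del: sat.simps)
  \<comment> \<open>At the end position there is no later witness, so both sides are false.\<close>
  qed auto
  then show ?thesis
    using fin_cong_inf[OF SF_quotient_algebra[OF C] R S(1)] by blast
qed

lemma class_determined_Since: "\<exists>S. fin_cong (SF C) S \<and> class_determined S (Since L f g)"
proof -
  let ?G = "\<lambda>s. {p. sat (p @ s) (Suc (length p)) (Since L f g)}"
  have G: "?G s = ?G s'" if "R s s'" for s s'
    by (rule Collect_cong) (rule Since_suffix_cong[OF that])
  have "finite (range ?G)" by (rule fin_cong_finite_image[OF R G])
  moreover have "range ?G \<subseteq> SF C" by (rule image_subsetI) (rule Since_prefixes_mem)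
  ultimately obtain S where S: "fin_cong (SF C) S" "\<forall>L\<in>range ?G. saturated S L"
    using fin_cong_exists_finite[OF SF_quotient_algebra[OF C]] by meson
  let ?T = "\<lambda>u v. R u v \<and> S u v"
  have prefix: "sat (p @ s) (Suc (length p)) (Since L f g) = sat (p' @ s) (Suc (length p')) (Since L f g)"
    if "S p p'" for p p' s
  proof -
    have "saturated S (?G s)" using S(2) by blast
    from saturated_iff[OF S(1) this that] show ?thesis unfolding mem_Collect_eq .
  qed
  have "class_determined ?T (Since L f g)"
    unfolding class_determined_def
  proof (intro conjI allI impI; elim conjE)
    fix u u' v v' a assume "R v v'" "S u u'"
    then have "R (a # v) (a # v')"
      using fin_cong_append[OF R fin_cong_refl[OF R], of v v' "[a]"] by simp
    then show "sat (u @ a # v) (Suc (length u)) (Since L f g) =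
        sat (u' @ a # v') (Suc (length u')) (Since L f g)"
      by (rule Since_suffix_cong[THEN trans]) (rule prefix[OF \<open>S u u'\<close>])
  next
    fix w w' assume "S w w'"
    then show "sat w (Suc (length w)) (Since L f g) = sat w' (Suc (length w')) (Since L f g)"
      using prefix[of w w' "[]"] by (simp del: sat.simps)
  qed simp_all
  then show ?thesis
    using fin_cong_inf[OF SF_quotient_algebra[OF C] R S(1)] by blast
qed

end

text \<open>Atomic formulas depend only on the kind of position and its label, so the congruence
  with a single class serves them; connectives intersect the congruences of their arguments.\<close>

lemma class_determined_exists:
  fixes C :: "'a::finite list set set"
  assumes C: "prevariety C" and "mlangs \<phi> \<subseteq> C"
  shows "\<exists>R. fin_cong (SF C) R \<and> class_determined R \<phi>"
proof -
  note SFC = SF_quotient_algebra[OF C]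
  have both: "\<exists>R. fin_cong (SF C) R \<and> class_determined R p \<and> class_determined R q"
    if p: "\<exists>R. fin_cong (SF C) R \<and> class_determined R p" and q: "\<exists>R. fin_cong (SF C) R \<and> class_determined R q"
    for p q
  proof -
    obtain R S where "fin_cong (SF C) R" "class_determined R p" "fin_cong (SF C) S" "class_determined S q"
      using p q by blast
    then show ?thesis
      using fin_cong_inf[OF SFC, of R S] class_determined_mono[of R p "\<lambda>u v. R u v \<and> S u v"]
        class_determined_mono[of S q "\<lambda>u v. R u v \<and> S u v"] by blast
  qed
  have triv: "fin_cong (SF C) (\<lambda>_ _. True)"
    unfolding fin_cong_def using SF_UNIV[OF C]
    by (auto intro!: equivpI simp: reflp_def symp_def transp_def)
  show ?thesis
    using assms(2)
  proof (induction \<phi>)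
    case TT
    show ?case using triv by (intro exI[of _ "\<lambda>_ _. True"]) (auto simp: class_determined_def)
  next
    case Min
    show ?case using triv by (intro exI[of _ "\<lambda>_ _. True"]) (auto simp: class_determined_def)
  next
    case Max
    show ?case using triv by (intro exI[of _ "\<lambda>_ _. True"]) (auto simp: class_determined_def)
  next
    case (Lab a)
    show ?case using triv by (intro exI[of _ "\<lambda>_ _. True"]) (auto simp: class_determined_def)
  next
    case (Or p q)
    then obtain R where "fin_cong (SF C) R" "class_determined R p" "class_determined R q"
      using both[of p q] by auto
    then show ?case by (intro exI[of _ R]) (simp add: class_determined_def)
  next
    case (And p q)
    then obtain R where "fin_cong (SF C) R" "class_determined R p" "class_determined R q"
      using both[of p q] by auto
    then show ?case by (intro exI[of _ R]) (simp add: class_determined_def)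
  next
    case (Neg p)
    then obtain R where "fin_cong (SF C) R" "class_determined R p" by auto
    then show ?case by (intro exI[of _ R]) (simp add: class_determined_def)
  next
    case (Until L p q)
    then obtain R where "fin_cong (SF C) R" "class_determined R p" "class_determined R q"
      using both[of p q] by auto
    then show ?case using Until.prems by (intro class_determined_Until[OF C]) (auto intro: SF.SF_base)
  next
    case (Since L p q)
    then obtain R where "fin_cong (SF C) R" "class_determined R p" "class_determined R q"
      using both[of p q] by auto
    then show ?case using Since.prems by (intro class_determined_Since[OF C]) (auto intro: SF.SF_base)
  qed
qed

lemma LTLP_subset_SF:
  fixes C :: "'a::finite list set set"
  assumes C: "prevariety C"
  shows "LTLP C \<subseteq> SF C"
proof
  fix K assume "K \<in> LTLP C"
  then obtain \<phi> where \<phi>: "K = lang_of \<phi>" "mlangs \<phi> \<subseteq> C" by (auto simp: LTLP_def)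
  obtain R where R: "fin_cong (SF C) R" "class_determined R \<phi>" using class_determined_exists[OF C \<phi>(2)] by blast
  have "saturated R K"
    unfolding saturated_def \<phi>(1) lang_of_def using class_determined_first[OF R(2)] by blast
  then show "K \<in> SF C" by (rule fin_cong_saturated_mem[OF SF_quotient_algebra[OF C] R(1)])
qed

section \<open>Languages of suffixes definable with until\<close>

text \<open>A non-strict until: the current letter is the first of \<open>u\<close>, counts towards
  \<open>L\<close> and is subject to \<open>P\<close>, and \<open>u = []\<close> is allowed.
  \<open>L\<close> is tested on \<open>concat u\<close>, so it keeps its meaning over every alphabet
  of words.\<close>

definition until_lang :: "'a list set \<Rightarrow> 'a list list set \<Rightarrow> 'a list list set \<Rightarrow> 'a list list set" where
  "until_lang L P S = {u @ v | u v. concat u \<in> L \<and> v \<in> S \<and>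
    (\<forall>u1 u2. u = u1 @ u2 \<longrightarrow> u2 \<noteq> [] \<longrightarrow> u2 @ v \<in> P)}"

lemma until_langI:
  assumes "w = u @ v" "concat u \<in> L" "v \<in> S" "\<And>u1 u2. u = u1 @ u2 \<Longrightarrow> u2 \<noteq> [] \<Longrightarrow> u2 @ v \<in> P"
  shows "w \<in> until_lang L P S"
  using assms unfolding until_lang_def by blast

lemma until_langE:
  assumes "w \<in> until_lang L P S"
  obtains u v where "w = u @ v" "concat u \<in> L" "v \<in> S"
    "\<forall>u1 u2. u = u1 @ u2 \<longrightarrow> u2 \<noteq> [] \<longrightarrow> u2 @ v \<in> P"
  using assms unfolding until_lang_def mem_Collect_eq by (elim exE conjE) (rule that)

text \<open>The letters of the alphabet \<open>X\<close> are themselves words over the original alphabet, so that all the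
  alphabets arising in the induction share one type. A language lists the suffixes \<open>w(i-1,n+1)\<close>
  starting with the letter at the current position \<open>i\<close>.\<close>

inductive_set future_langs ::
  "('a list \<Rightarrow> 'a list \<Rightarrow> bool) \<Rightarrow> 'a list set \<Rightarrow> 'a list list set set" for R X where
  future_empty: "{} \<in> future_langs R X"
| future_union: "P \<in> future_langs R X \<Longrightarrow> S \<in> future_langs R X \<Longrightarrow> P \<union> S \<in> future_langs R X"
| future_compl: "P \<in> future_langs R X \<Longrightarrow> lists X - P \<in> future_langs R X"
| future_Cons: "x \<in> X \<Longrightarrow> P \<in> future_langs R X \<Longrightarrow> (#) x ` P \<in> future_langs R X"
| future_until: "saturated R L \<Longrightarrow> P \<in> future_langs R X \<Longrightarrow> S \<in> future_langs R X \<Longrightarrow>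
    until_lang L P S \<in> future_langs R X"

lemma future_subset: "P \<in> future_langs R X \<Longrightarrow> P \<subseteq> lists X"
proof (induction rule: future_langs.induct)
  case (future_until L P S)
  show ?case
  proof
    fix w assume "w \<in> until_lang L P S"
    then obtain u v where uv: "w = u @ v" "concat u \<in> L" "v \<in> S"
      "\<forall>u1 u2. u = u1 @ u2 \<longrightarrow> u2 \<noteq> [] \<longrightarrow> u2 @ v \<in> P"
      by (rule until_langE)
    show "w \<in> lists X"
    proof (cases "u = []")
      case True
      then show ?thesis using uv(1,3) future_until.IH by auto
    next
      case False
      then show ?thesis using uv(1) uv(4)[rule_format, of "[]" u] future_until.IH by auto
    qed
  qed
next
  case (future_Cons x P)
  show ?case
  proof (rule image_subsetI)
    fix w assume "w \<in> P"
    then have "w \<in> lists X" using future_Cons.IH by blast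
    then show "x # w \<in> lists X" using future_Cons.hyps(1) by simp
  qed
qed auto

lemma future_lists: "lists X \<in> future_langs R X"
  using future_compl[OF future_empty] by simp

lemma future_inter:
  assumes "P \<in> future_langs R X" "S \<in> future_langs R X"
  shows "P \<inter> S \<in> future_langs R X"
proof -
  have "P \<inter> S = lists X - ((lists X - P) \<union> (lists X - S))"
    using assms[THEN future_subset] by blast
  then show ?thesis using assms by (simp only: future_compl future_union)
qed

lemma future_diff:
  assumes "P \<in> future_langs R X" "S \<in> future_langs R X"
  shows "P - S \<in> future_langs R X"
proof -
  have "P - S = P \<inter> (lists X - S)" using assms[THEN future_subset] by blast
  then show ?thesis using assms by (simp only: future_compl future_inter)
qed

lemma future_UN:
  assumes "finite A" "\<And>a. a \<in> A \<Longrightarrow> P a \<in> future_langs R X"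
  shows "(\<Union>a\<in>A. P a) \<in> future_langs R X"
  using assms by induction (auto intro: future_empty future_union)

lemma future_ball:
  assumes "finite A" "\<And>a. a \<in> A \<Longrightarrow> {w \<in> lists X. P a w} \<in> future_langs R X"
  shows "{w \<in> lists X. \<forall>a\<in>A. P a w} \<in> future_langs R X"
proof -
  have "{w \<in> lists X. \<forall>a\<in>A. P a w} = lists X - (\<Union>a\<in>A. lists X - {w \<in> lists X. P a w})"
    by blast
  moreover have "lists X - (\<Union>a\<in>A. lists X - {w \<in> lists X. P a w}) \<in> future_langs R X"
    by (intro future_compl future_UN assms)
  ultimately show ?thesis by simp
qed

lemma future_Nil:
  assumes "finite X"
  shows "{[]} \<in> future_langs R X"
proof -
  have "{[]} = lists X - (\<Union>x\<in>X. (#) x ` lists X)"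
  proof (intro equalityI subsetI)
    fix w assume "w \<in> lists X - (\<Union>x\<in>X. (#) x ` lists X)"
    then show "w \<in> {[]}" by (cases w) auto
  qed auto
  moreover have "lists X - (\<Union>x\<in>X. (#) x ` lists X) \<in> future_langs R X"
    by (intro future_compl future_UN assms future_Cons future_lists)
  ultimately show ?thesis by simp
qed

text \<open>An until whose target is the end of the word forces \<open>u\<close> to be the whole
  word.\<close>

lemma future_concat:
  assumes "finite X" "saturated R L"
  shows "{w \<in> lists X. concat w \<in> L} \<in> future_langs R X"
proof -
  have "{w \<in> lists X. concat w \<in> L} = until_lang L (lists X) {[]}"
  proof (intro equalityI subsetI)
    fix w assume "w \<in> until_lang L (lists X) {[]}"
    then obtain u v where u: "w = u @ v" "concat u \<in> L" "v \<in> {[]}"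
        "\<forall>u1 u2. u = u1 @ u2 \<longrightarrow> u2 \<noteq> [] \<longrightarrow> u2 @ v \<in> lists X"
      by (rule until_langE)
    have "w \<in> lists X" using u(1,3) u(4)[rule_format, of "[]" u] by (cases "u = []") auto
    then show "w \<in> {w \<in> lists X. concat w \<in> L}" using u(1,2,3) by simp
  next
    fix w assume "w \<in> {w \<in> lists X. concat w \<in> L}"
    then show "w \<in> until_lang L (lists X) {[]}"
      by (intro until_langI[where u = w and v = "[]"]) auto
  qed
  then show ?thesis using future_until[OF assms(2) future_lists future_Nil[OF assms(1)]] by simp
qed

section \<open>Words cut at a marked letter\<close>

lemma first_occurrence_unique:
  "v @ c # r = v' @ c # r' \<Longrightarrow> c \<notin> set v \<Longrightarrow> c \<notin> set v' \<Longrightarrow> v = v' \<and> r = r'"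
proof (induction v arbitrary: v')
  case Nil
  then show ?case by (cases v') auto
next
  case (Cons a v)
  then show ?case by (cases v') auto
qed

lemma last_occurrence_unique:
  assumes "x @ c # v = x' @ c # v'" "c \<notin> set v" "c \<notin> set v'"
  shows "x = x' \<and> v = v'"
proof -
  have "rev v @ c # rev x = rev v' @ c # rev x'"
    using arg_cong[OF assms(1), of rev] by simp
  then show ?thesis using first_occurrence_unique[of "rev v" c "rev x" "rev v'" "rev x'"] assms(2,3)
    by simp
qed

lemma lists_remove_iff: "v \<in> lists (X - {c}) \<longleftrightarrow> v \<in> lists X \<and> c \<notin> set v"
  by auto

abbreviation mark_conc :: "'b \<Rightarrow> 'b list set \<Rightarrow> 'b list set \<Rightarrow> 'b list set" where
  "mark_conc c V S \<equiv> {v @ c # r | v r. v \<in> V \<and> r \<in> S}"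

lemma mark_conc_first:
  assumes "v @ c # r \<in> mark_conc c V S" "V \<subseteq> lists (X - {c})" "v \<in> lists (X - {c})"
  shows "v \<in> V \<and> r \<in> S"
proof -
  obtain v' r' where "v @ c # r = v' @ c # r'" "v' \<in> V" "r' \<in> S" using assms(1) by blast
  moreover have "c \<notin> set v'" "c \<notin> set v"
    using \<open>v' \<in> V\<close> assms(2,3) by auto
  ultimately show ?thesis using first_occurrence_unique[of v c r v' r'] by simp
qed

lemma saturated_UNIV: "saturated R UNIV"
  by (simp add: saturated_def)

lemma mark_free_until:
  assumes "\<And>u1 u2. u = u1 @ u2 \<Longrightarrow> u2 \<noteq> [] \<Longrightarrow> u2 @ z \<in> lists X - (#) c ` lists X"
  shows "u \<in> lists (X - {c})"
proof (rule in_listsI, rule ballI)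
  fix x assume "x \<in> set u"
  then obtain u1 u3 where "u = u1 @ x # u3" by (meson split_list)
  then have "x # u3 @ z \<in> lists X - (#) c ` lists X" using assms[of u1 "x # u3"] by simp
  then show "x \<in> X - {c}" by (auto simp: image_iff)
qed

text \<open>Relativization to the part before the first \<open>c\<close>, by induction on
  \<open>V\<close>: a path kept inside \<open>?N\<close>, the words not opening with
  \<open>c\<close>, cannot run across the mark, and the mark is the first one because words of
  \<open>V\<close> avoid \<open>c\<close>.\<close>

lemma future_mark_conc:
  assumes c: "c \<in> X" and S: "S \<in> future_langs R X" and "V \<in> future_langs R (X - {c})"
  shows "mark_conc c V S \<in> future_langs R X"
  using assms(3)
proof (induction rule: future_langs.induct)
  case future_empty
  then show ?case using future_langs.future_empty by simp
next
  case (future_union P P')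
  have "mark_conc c (P \<union> P') S = mark_conc c P S \<union> mark_conc c P' S" by blast
  then show ?case using future_langs.future_union[OF future_union.IH] by simp
next
  case (future_compl P)
  let ?N = "lists X - (#) c ` lists X"
  have N: "?N \<in> future_langs R X" by (intro future_langs.future_compl future_Cons future_lists c)
  have "mark_conc c (lists (X - {c})) S = until_lang UNIV ?N ((#) c ` S)"
  proof (intro equalityI subsetI)
    fix w assume "w \<in> mark_conc c (lists (X - {c})) S"
    then obtain v r where w: "w = v @ c # r" "v \<in> lists (X - {c})" "r \<in> S" by blast
    then have "r \<in> lists X" using future_subset[OF S] by blast
    show "w \<in> until_lang UNIV ?N ((#) c ` S)"
    proof (rule until_langI[of _ v "c # r"])
      fix u1 u2 assume "v = u1 @ u2" "u2 \<noteq> []"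
      then show "u2 @ c # r \<in> ?N" using w(2) c \<open>r \<in> lists X\<close> by (cases u2) auto
    qed (use w in auto)
  next
    fix w assume "w \<in> until_lang UNIV ?N ((#) c ` S)"
    then obtain u z where w: "w = u @ z" "concat u \<in> UNIV" "z \<in> (#) c ` S"
      "\<forall>u1 u2. u = u1 @ u2 \<longrightarrow> u2 \<noteq> [] \<longrightarrow> u2 @ z \<in> ?N"
      by (rule until_langE)
    have "u \<in> lists (X - {c})" by (rule mark_free_until) (rule w(4)[rule_format])
    then show "w \<in> mark_conc c (lists (X - {c})) S" using w(1,3) by blast
  qed
  then have base: "mark_conc c (lists (X - {c})) S \<in> future_langs R X"
    using future_until[OF saturated_UNIV N future_Cons[OF c S]] by simp
  \<comment> \<open>Complement commutes with marking because the split at the first \<open>c\<close>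
    is unique.\<close>
  have "mark_conc c (lists (X - {c}) - P) S = mark_conc c (lists (X - {c})) S - mark_conc c P S"
  proof (intro equalityI subsetI DiffI notI)
    fix w assume "w \<in> mark_conc c (lists (X - {c}) - P) S" and w: "w \<in> mark_conc c P S"
    then obtain v r where v: "w = v @ c # r" "v \<in> lists (X - {c}) - P" by blast
    then show False
      using mark_conc_first[of v c r P S X] w future_subset[OF future_compl.hyps] by blast
  qed blast+
  then show ?case using future_diff[OF base future_compl.IH] by simp
next
  case (future_Cons b P)
  have "mark_conc c ((#) b ` P) S = (#) b ` mark_conc c P S" by (auto simp: image_iff) (metis append_Cons)+
  then show ?case using future_langs.future_Cons[OF _ future_Cons.IH, of b] future_Cons.hyps by simp
next
  case (future_until L P T)
  let ?N = "lists X - (#) c ` lists X"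
  have N: "?N \<in> future_langs R X" by (intro future_langs.future_compl future_Cons future_lists c)
  note sub = future_subset[OF future_until.hyps(2)] future_subset[OF future_until.hyps(3)]
  \<comment> \<open>Without \<open>?N\<close>, having \<open>[] \<in> P\<close> would allow
    \<open>u\<close> to contain \<open>c\<close>: then \<open>mark_conc c P S\<close> has words that
    open with \<open>c\<close>.\<close>
  have "mark_conc c (until_lang L P T) S = until_lang L (mark_conc c P S \<inter> ?N) (mark_conc c T S)"
  proof (intro equalityI subsetI)
    fix w assume "w \<in> mark_conc c (until_lang L P T) S"
    then obtain z r where w: "w = z @ c # r" "z \<in> until_lang L P T" "r \<in> S" by blast
    obtain u v where z: "z = u @ v" "concat u \<in> L" "v \<in> T"
      "\<forall>u1 u2. u = u1 @ u2 \<longrightarrow> u2 \<noteq> [] \<longrightarrow> u2 @ v \<in> P"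
      using w(2) by (rule until_langE)
    have "r \<in> lists X" using w(3) future_subset[OF S] by blast
    show "w \<in> until_lang L (mark_conc c P S \<inter> ?N) (mark_conc c T S)"
    proof (rule until_langI[of _ u "v @ c # r"])
      show "v @ c # r \<in> mark_conc c T S" using z(3) w(3) by blast
      fix u1 u2 assume u2: "u = u1 @ u2" "u2 \<noteq> []"
      then have P: "u2 @ v \<in> P" by (rule z(4)[rule_format])
      then have "(u2 @ v) @ c # r \<in> mark_conc c P S" using w(3) by blast
      moreover have "u2 @ v \<in> lists (X - {c})" using P sub by blast
      then have "u2 @ v @ c # r \<in> ?N" using u2(2) c \<open>r \<in> lists X\<close> by (cases u2) auto
      ultimately show "u2 @ v @ c # r \<in> mark_conc c P S \<inter> ?N" by simp
    qed (use w z in auto)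
  next
    fix w assume "w \<in> until_lang L (mark_conc c P S \<inter> ?N) (mark_conc c T S)"
    then obtain u z where w: "w = u @ z" "concat u \<in> L" "z \<in> mark_conc c T S"
      "\<forall>u1 u2. u = u1 @ u2 \<longrightarrow> u2 \<noteq> [] \<longrightarrow> u2 @ z \<in> mark_conc c P S \<inter> ?N"
      by (rule until_langE)
    have u: "u \<in> lists (X - {c})" by (rule mark_free_until) (use w(4)[rule_format] in blast)
    obtain v r where z: "z = v @ c # r" "v \<in> T" "r \<in> S" using w(3) by blast
    have v: "v \<in> lists (X - {c})" using z(2) sub by blast
    have "u @ v \<in> until_lang L P T"
    proof (rule until_langI[OF refl w(2) z(2)])
      fix u1 u2 assume u2: "u = u1 @ u2" "u2 \<noteq> []"
      then have "(u2 @ v) @ c # r \<in> mark_conc c P S" using w(4)[rule_format, OF u2] z(1) by auto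
      moreover have "u2 @ v \<in> lists (X - {c})" using u v u2(1) by auto
      ultimately show "u2 @ v \<in> P" using mark_conc_first[of "u2 @ v" c r P S X] sub by blast
    qed
    moreover have "w = (u @ v) @ c # r" using w(1) z(1) by simp
    ultimately show "w \<in> mark_conc c (until_lang L P T) S" using z(3) by blast
  qed
  then show ?case
    using future_langs.future_until[OF future_until.hyps(1) future_inter[OF future_until.IH(1) N]
        future_until.IH(2)] by simp
qed

lemma future_lists_remove:
  assumes "c \<in> X"
  shows "lists (X - {c}) \<in> future_langs R X"
proof -
  have "lists (X - {c}) = lists X - mark_conc c (lists (X - {c})) (lists X)"
  proof (intro equalityI subsetI DiffI notI)
    fix w assume w: "w \<in> lists X - mark_conc c (lists (X - {c})) (lists X)"
    have "c \<notin> set w"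
    proof
      assume "c \<in> set w"
      then obtain v r where "w = v @ c # r" "c \<notin> set v" by (meson split_list_first)
      then show False using w by auto
    qed
    then show "w \<in> lists (X - {c})" using w by auto
  qed auto
  then show ?thesis
    using future_compl[OF future_mark_conc[OF assms future_lists future_lists]] by simp
qed

text \<open>Only complement refers to the alphabet; over \<open>X\<close> it becomes a difference
  from \<open>lists (X - {c})\<close>, which is itself definable.\<close>

lemma future_remove_subset:
  assumes "c \<in> X" "V \<in> future_langs R (X - {c})"
  shows "V \<in> future_langs R X"
  using assms(2)
proof (induction rule: future_langs.induct)
  case (future_compl P)
  then show ?case by (intro future_diff future_lists_remove assms(1))
qed (auto intro: future_langs.intros)

section \<open>Sequences of blocks as words over a new alphabet\<close>

text \<open>The argument \<open>acc\<close> holds the part of the current block read so far; the unfinished last block is dropped.\<close>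

primrec blocks :: "('a list \<Rightarrow> 'a list) \<Rightarrow> 'a list \<Rightarrow> 'a list \<Rightarrow> 'a list list \<Rightarrow> 'a list list" where
  "blocks rep c acc [] = []"
| "blocks rep c acc (x # w) =
    (if x = c then rep (acc @ c) # blocks rep c [] w else blocks rep c (acc @ x) w)"

lemma blocks_mark_free: "c \<notin> set v \<Longrightarrow> blocks rep c acc v = []"
  by (induction v arbitrary: acc) auto

lemma blocks_first:
  "c \<notin> set v \<Longrightarrow> blocks rep c acc (v @ c # r) = rep (acc @ concat v @ c) # blocks rep c [] r"
  by (induction v arbitrary: acc) auto

lemma blocks_append:
  "blocks rep c acc (x @ c # z) = blocks rep c acc (x @ [c]) @ blocks rep c [] z"
  by (induction x arbitrary: acc) auto

lemma blocks_snoc_neq_Nil: "blocks rep c acc (x @ [c]) \<noteq> []"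
  by (induction x arbitrary: acc) auto

text \<open>Cuts of the block sequence after a nonempty part are exactly cuts of the word right
  after some \<open>c\<close>; the unfinished last block stays inside \<open>z\<close>.\<close>

lemma blocks_split:
  assumes "blocks rep c [] w = u @ v" "u \<noteq> []"
  shows "\<exists>x z. w = x @ c # z \<and> blocks rep c [] (x @ [c]) = u \<and> blocks rep c [] z = v"
  using assms
proof (induction u arbitrary: w)
  case (Cons y u)
  have "c \<in> set w" using Cons.prems(1) blocks_mark_free[of c w rep "[]"] by auto
  then obtain b r where w: "w = b @ c # r" "c \<notin> set b" by (meson split_list_first)
  have y: "y = rep (concat b @ c)" and r: "blocks rep c [] r = u @ v"
    using Cons.prems(1) blocks_first[OF w(2), of rep "[]" r] w(1) by auto
  show ?case
  proof (cases "u = []")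
    case True
    then show ?thesis using w y r blocks_first[OF w(2), of rep "[]" "[]"] by auto
  next
    case False
    then obtain x z where x: "r = x @ c # z" "blocks rep c [] (x @ [c]) = u" "blocks rep c [] z = v"
      using Cons.IH[OF r] by blast
    have "w = (b @ c # x) @ c # z" using w x by simp
    moreover have "blocks rep c [] ((b @ c # x) @ [c]) = y # u"
      using blocks_first[OF w(2), of rep "[]" "x @ [c]"] x y by simp
    ultimately show ?thesis using x(3) by blast
  qed
qed simp

text \<open>Each block is congruent to its representative, so a language saturated by
  \<open>R\<close> cannot tell a word ending in \<open>c\<close> from its sequence of
  representatives.\<close>

lemma blocks_cong:
  assumes R: "fin_cong D R" and rep: "\<And>x. R x (rep x)"
  shows "R (acc @ concat x @ c) (concat (blocks rep c acc (x @ [c])))"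
proof (induction x arbitrary: acc)
  case Nil
  show ?case using rep by simp
next
  case (Cons y x)
  show ?case
  proof (cases "y = c")
    case True
    have "R ((acc @ c) @ [] @ concat x @ c) (rep (acc @ c) @ concat (blocks rep c [] (x @ [c])))"
      by (intro fin_cong_append[OF R rep] Cons.IH)
    then show ?thesis using True by simp
  next
    case False
    then show ?thesis using Cons.IH[of "acc @ y"] by simp
  qed
qed

text \<open>Representatives agree with their blocks only on \<open>Q\<close>; stability of
  \<open>Q\<close> ensures that every intermediate state is one where they agree.\<close>

lemma blocks_action:
  assumes rep: "\<And>x q. q \<in> Q \<Longrightarrow> lquot (rep x) q = lquot x q"
    and X: "\<And>x q. x \<in> X \<Longrightarrow> q \<in> Q \<Longrightarrow> lquot x q \<in> Q" and c: "c \<in> X"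
    and "x \<in> lists X" "\<And>q. q \<in> Q \<Longrightarrow> lquot acc q \<in> Q" "q \<in> Q"
  shows "lquot (concat (blocks rep c acc (x @ [c]))) q = lquot (acc @ concat x @ c) q"
  using assms(4-)
proof (induction x arbitrary: acc q rule: list.induct)
  case Nil
  then show ?case using rep by simp
next
  case (Cons y x)
  show ?case
  proof (cases "y = c")
    case True
    have "lquot (acc @ c) q \<in> Q" using Cons.prems X[OF c] by (simp add: lquot_append)
    then show ?thesis
      using True Cons.IH[of "[]" "lquot (acc @ c) q"] Cons.prems rep
      by (simp add: lquot_append)
  next
    case False
    have "lquot (acc @ y) q \<in> Q" if "q \<in> Q" for q
      using Cons.prems(1,2) X[of y] that by (simp add: lquot_append)
    then show ?thesis using False Cons.IH[of "acc @ y" q] Cons.prems by simp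
  qed
qed

lemma blocks_lists:
  assumes "w \<in> lists X"
  shows "blocks rep c [] w \<in> lists ((\<lambda>v. rep (concat v @ c)) ` lists (X - {c}))"
  using assms
proof (induction "length w" arbitrary: w rule: less_induct)
  case less
  show ?case
  proof (cases "c \<in> set w")
    case True
    then obtain v r where w: "w = v @ c # r" "c \<notin> set v" by (meson split_list_first)
    then have "blocks rep c [] r \<in> lists ((\<lambda>v. rep (concat v @ c)) ` lists (X - {c}))"
      using less by auto
    moreover have "v \<in> lists (X - {c})" using w less.prems by auto
    ultimately show ?thesis using blocks_first[OF w(2), of rep "[]" r] w(1) by auto
  next
    case False
    then show ?thesis by (simp add: blocks_mark_free)
  qed
qed

text \<open>Translates descriptions over the block alphabet \<open>Y\<close> back to
  \<open>X\<close>. Reading a block letter \<open>y\<close> means reading a \<open>c\<close>-free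
  word from the fibre of \<open>y\<close> and then \<open>c\<close>; an until must be made to test
  \<open>P\<close> only where a block starts.\<close>

lemma future_blocks_vimage:
  assumes R: "fin_cong D R" and rep: "\<And>x. R x (rep x)" and c: "c \<in> X"
    and Y: "Y = (\<lambda>v. rep (concat v @ c)) ` lists (X - {c})"
    and fibre: "\<And>y. y \<in> Y \<Longrightarrow> {v \<in> lists (X - {c}). rep (concat v @ c) = y} \<in> future_langs R (X - {c})"
    and "K \<in> future_langs R Y"
  shows "{w \<in> lists X. blocks rep c [] w \<in> K} \<in> future_langs R X"
  using assms(6)
proof (induction rule: future_langs.induct)
  case future_empty
  then show ?case using future_langs.future_empty by simp
next
  case (future_union P S)
  have "{w \<in> lists X. blocks rep c [] w \<in> P \<union> S} =
      {w \<in> lists X. blocks rep c [] w \<in> P} \<union> {w \<in> lists X. blocks rep c [] w \<in> S}" by blast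
  then show ?case using future_langs.future_union[OF future_union.IH] by simp
next
  case (future_compl P)
  have "{w \<in> lists X. blocks rep c [] w \<in> lists Y - P} = lists X - {w \<in> lists X. blocks rep c [] w \<in> P}"
    using blocks_lists[of _ X rep c] unfolding Y by blast
  then show ?case using future_langs.future_compl[OF future_compl.IH] by simp
next
  case (future_Cons y P)
  have "{w \<in> lists X. blocks rep c [] w \<in> (#) y ` P} =
    mark_conc c {v \<in> lists (X - {c}). rep (concat v @ c) = y} {w \<in> lists X. blocks rep c [] w \<in> P}"
    (is "?l = ?r")
  proof (intro equalityI subsetI)
    fix w assume w: "w \<in> ?l"
    then have "c \<in> set w" using blocks_mark_free[of c w rep "[]"] by (cases "c \<in> set w") auto
    then obtain v r where v: "w = v @ c # r" "c \<notin> set v" by (meson split_list_first)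
    then have "rep (concat v @ c) = y" "blocks rep c [] r \<in> P"
      using blocks_first[OF v(2), of rep "[]" r] w by auto
    moreover have "v \<in> lists (X - {c})" "r \<in> lists X" using w v by auto
    ultimately show "w \<in> ?r" using v(1) by blast
  next
    fix w assume "w \<in> ?r"
    then obtain v r where v: "w = v @ c # r" "v \<in> lists (X - {c})" "rep (concat v @ c) = y"
      "r \<in> lists X" "blocks rep c [] r \<in> P" by blast
    then have "c \<notin> set v" by auto
    then show "w \<in> ?l" using v c blocks_first[of c v rep "[]" r] by auto
  qed
  then show ?case using future_mark_conc[OF c future_Cons.IH fibre[OF future_Cons.hyps(1)]] by simp
next
  case (future_until L P S)
  let ?P = "{w \<in> lists X. blocks rep c [] w \<in> P}" and ?S = "{w \<in> lists X. blocks rep c [] w \<in> S}"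
  \<comment> \<open>Inside the word, blocks start right after a \<open>c\<close>. So the guard is an
    implication: if the current letter is \<open>c\<close>, the suffix following it lies in
    \<open>?P\<close>.\<close>
  let ?N = "(lists X - (#) c ` lists X) \<union> (#) c ` ?P"
  have N: "?N \<in> future_langs R X"
    by (intro future_langs.future_union future_compl future_Cons future_lists c future_until.IH)
  have sat: "saturated R (rquot L c)"
    using future_until.hyps(1) fin_cong_append[OF R _ fin_cong_refl[OF R]]
    unfolding saturated_def rquot_def by blast
  \<comment> \<open>An empty \<open>u\<close> puts \<open>S\<close> at the start. Otherwise the path
    stops at the \<open>c\<close> closing the last block of \<open>u\<close>, and the right quotient
    of \<open>L\<close> accounts for this letter. The first block has no \<open>c\<close> before it,
    hence the separate conjunct \<open>?P\<close>.\<close>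
  have "{w \<in> lists X. blocks rep c [] w \<in> until_lang L P S} =
    (if [] \<in> L then ?S else {}) \<union> (?P \<inter> until_lang (rquot L c) ?N ((#) c ` ?S))" (is "?l = ?r")
  proof (intro equalityI subsetI)
    fix w assume w: "w \<in> ?l"
    from w have "blocks rep c [] w \<in> until_lang L P S" by blast
    then obtain u v where uv: "blocks rep c [] w = u @ v" "concat u \<in> L" "v \<in> S"
      "\<forall>u1 u2. u = u1 @ u2 \<longrightarrow> u2 \<noteq> [] \<longrightarrow> u2 @ v \<in> P"
      by (rule until_langE)
    show "w \<in> ?r"
    proof (cases "u = []")
      case True
      then show ?thesis using uv w by simp
    next
      case False
      obtain x z where x: "w = x @ c # z" "blocks rep c [] (x @ [c]) = u" "blocks rep c [] z = v"
        using blocks_split[OF uv(1) False] by blast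
      have "w \<in> ?P" using uv(4)[rule_format, of "[]" u] uv(1) False w by simp
      moreover have "w \<in> until_lang (rquot L c) ?N ((#) c ` ?S)"
      proof (rule until_langI[OF x(1)])
        have "R (concat u) (concat x @ c)"
          using fin_cong_sym[OF R blocks_cong[OF R rep, of "[]" x c]] x(2) by simp
        then show "concat x \<in> rquot L c"
          using future_until.hyps(1) uv(2) unfolding saturated_def rquot_def by blast
        show "c # z \<in> (#) c ` ?S" using x w uv(3) by auto
        fix x1 x2 assume x2: "x = x1 @ x2" "x2 \<noteq> []"
        show "x2 @ c # z \<in> ?N"
        proof (cases "hd x2 = c")
          case True
          then obtain x3 where x3: "x2 = c # x3" using x2(2) by (cases x2) auto
          have "u = blocks rep c [] (x1 @ [c]) @ blocks rep c [] (x3 @ [c])"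
            using blocks_append[of rep c "[]" x1 "x3 @ [c]"] x(2) x2(1) x3 by simp
          moreover have "blocks rep c [] (x3 @ [c]) \<noteq> []"
            by (rule blocks_snoc_neq_Nil)
          ultimately have "blocks rep c [] (x3 @ [c]) @ v \<in> P" by (rule uv(4)[rule_format])
          then have "blocks rep c [] (x3 @ c # z) \<in> P" using blocks_append[of rep c "[]" x3 z] x(3) by simp
          then have "x3 @ c # z \<in> ?P" using w x(1) x2(1) x3 by auto
          then show ?thesis using x3 by simp
        next
          case False
          then have "x2 @ c # z \<in> lists X - (#) c ` lists X" using w x(1) x2 by (cases x2) auto
          then show ?thesis by blast
        qed
      qed
      ultimately show ?thesis by blast
    qed
  next
    fix w assume w: "w \<in> ?r"
    show "w \<in> ?l"
    proof (cases "[] \<in> L \<and> w \<in> ?S")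
      case True
      then have "blocks rep c [] w \<in> until_lang L P S"
        by (intro until_langI[of _ "[]"]) auto
      then show ?thesis using True by simp
    next
      case False
      then have P: "w \<in> ?P" and "w \<in> until_lang (rquot L c) ?N ((#) c ` ?S)"
        using w by (auto split: if_splits)
      then obtain x z' where x: "w = x @ z'" "concat x \<in> rquot L c" "z' \<in> (#) c ` ?S"
        "\<forall>u1 u2. x = u1 @ u2 \<longrightarrow> u2 \<noteq> [] \<longrightarrow> u2 @ z' \<in> ?N"
        by (elim until_langE)
      then obtain z where z: "z' = c # z" "z \<in> ?S" by blast
      let ?u = "blocks rep c [] (x @ [c])" and ?v = "blocks rep c [] z"
      have w_eq: "blocks rep c [] w = ?u @ ?v" using blocks_append[of rep c "[]" x z] x(1) z(1) by simp
      have "blocks rep c [] w \<in> until_lang L P S"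
      proof (rule until_langI[OF w_eq])
        show "concat ?u \<in> L"
          using blocks_cong[OF R rep, of "[]" x c] x(2) future_until.hyps(1)
          unfolding saturated_def rquot_def by auto
        show "?v \<in> S" using z(2) by blast
        fix u1 u2 assume u: "?u = u1 @ u2" "u2 \<noteq> []"
        show "u2 @ ?v \<in> P"
        proof (cases "u1 = []")
          case True
          then show ?thesis using u P w_eq by simp
        next
          case False
          obtain x1 z1 where x1: "x @ [c] = x1 @ c # z1" "blocks rep c [] (x1 @ [c]) = u1"
              "blocks rep c [] z1 = u2"
            using blocks_split[OF u(1) False] by blast
          \<comment> \<open>Since \<open>u2\<close> is nonempty, the \<open>c\<close> closing
            \<open>u1\<close> is not the appended one but lies in \<open>x\<close>, where the guard
            \<open>?N\<close> applies.\<close>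
          have "z1 \<noteq> []" using x1(3) u(2) by auto
          then obtain x3 where z1: "z1 = x3 @ [c]" using x1(1)
            by (metis last_ConsR last_appendR last_snoc append_butlast_last_id list.discI)
          then have x3: "x = x1 @ c # x3" using x1(1) by simp
          then have "(c # x3) @ c # z \<in> ?N" using x(4)[rule_format, of x1 "c # x3"] z(1) by simp
          then have "x3 @ c # z \<in> ?P \<or> c # x3 @ c # z \<notin> (#) c ` lists X" by auto
          moreover have "x3 @ c # z \<in> lists X" using P x(1) x3 z(1) by auto
          ultimately have "blocks rep c [] (x3 @ c # z) \<in> P" by blast
          then show ?thesis using blocks_append[of rep c "[]" x3 z] x1(3) z1 by simp
        qed
      qed
      then show ?thesis using P by simp
    qed
  qed
  moreover have "(if [] \<in> L then ?S else {}) \<in> future_langs R X"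
    using future_until.IH(2) by (simp add: future_langs.future_empty)
  ultimately show ?case
    using future_langs.future_union[OF _ future_inter[OF future_until.IH(1)
        future_langs.future_until[OF sat N future_Cons[OF c future_until.IH(2)]]]] by simp
qed

section \<open>Defining the action of words on states\<close>

abbreviation word_pow :: "'a list \<Rightarrow> nat \<Rightarrow> 'a list" where
  "word_pow x n \<equiv> concat (replicate n x)"

lemma word_pow_add: "word_pow x (m + n) = word_pow x m @ word_pow x n"
  by (simp add: replicate_add)

text \<open>Pigeonhole on the classes of powers yields a threshold \<open>i\<close> and a period
  \<open>Suc d\<close>. The exponent is a successor so that one factor can be split off, the
  remaining power then acting as an inverse in the group case.\<close>

lemma idempotent_power_exists:
  assumes R: "fin_cong D R"
  shows "\<exists>k. R (word_pow x (Suc k)) (word_pow x (Suc k) @ word_pow x (Suc k))"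
proof -
  have "finite (range (\<lambda>n. {v. R (word_pow x n) v}))"
    using fin_cong_finite[OF R, of "range (word_pow x)"] by (simp add: image_image)
  then have "\<not> inj (\<lambda>n. {v. R (word_pow x n) v})"
    using finite_imageD[of _ "UNIV :: nat set"] infinite_UNIV_nat by blast
  then obtain i j where "i \<noteq> j" "{v. R (word_pow x i) v} = {v. R (word_pow x j) v}"
    unfolding inj_def by blast
  moreover have "R (word_pow x j) (word_pow x j)" "R (word_pow x i) (word_pow x i)"
    by (rule fin_cong_refl[OF R])+
  ultimately obtain i d where d: "R (word_pow x i) (word_pow x (i + Suc d))"
    by (metis less_imp_Suc_add linorder_neqE_nat add_Suc_right mem_Collect_eq)
  have step: "R (word_pow x (i + m)) (word_pow x (i + m + Suc d * t))" for m t
  proof (induction t)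
    case 0
    show ?case by (simp add: fin_cong_refl[OF R])
  next
    case (Suc t)
    have "R (word_pow x i @ word_pow x (m + Suc d * t))
        (word_pow x (i + Suc d) @ word_pow x (m + Suc d * t))"
      by (rule fin_cong_append[OF R d fin_cong_refl[OF R]])
    then have "R (word_pow x (i + m + Suc d * t)) (word_pow x (i + m + Suc d * Suc t))"
      unfolding word_pow_add[symmetric] by (simp only: mult_Suc_right ac_simps)
    then show ?case by (rule fin_cong_trans[OF R Suc.IH])
  qed
  \<comment> \<open>Chosen so that \<open>Suc ?k = Suc d * Suc i\<close>: a multiple of the period
    beyond the threshold, so doubling it does not change the class.\<close>
  let ?k = "i + (i * d + d)"
  have k: "Suc ?k = Suc d * Suc i" by simp
  have "R (word_pow x (i + (i * d + Suc d))) (word_pow x (i + (i * d + Suc d) + Suc d * Suc i))"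
    by (rule step)
  moreover have "i + (i * d + Suc d) = Suc ?k" by simp
  ultimately have "R (word_pow x (Suc ?k)) (word_pow x (Suc ?k + Suc ?k))"
    unfolding k[symmetric] by simp
  then show ?thesis unfolding word_pow_add by blast
qed

text \<open>Aperiodicity at the state \<open>q\<close>, a left quotient in the application, only for
  words idempotent modulo \<open>R\<close>; other words may permute states in nontrivial
  cycles.\<close>

definition pumpable :: "('a list \<Rightarrow> 'a list \<Rightarrow> bool) \<Rightarrow> nat \<Rightarrow> 'a list set \<Rightarrow> bool" where
  "pumpable R n q \<longleftrightarrow> (\<forall>x. R x (x @ x) \<longrightarrow> lquot (word_pow x n) q = lquot (word_pow x (Suc n)) q)"

definition permutes_states :: "'a list set set \<Rightarrow> 'a list \<Rightarrow> bool" where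
  "permutes_states Q z \<longleftrightarrow> (\<forall>q\<in>Q. lquot z q \<in> Q) \<and> inj_on (lquot z) Q"

lemma permutes_states_append:
  assumes "permutes_states Q x" "permutes_states Q y"
  shows "permutes_states Q (x @ y)"
  unfolding permutes_states_def
proof (intro conjI ballI inj_onI)
  fix p q assume "p \<in> Q" "q \<in> Q" "lquot (x @ y) p = lquot (x @ y) q"
  then show "p = q"
    using assms unfolding permutes_states_def lquot_append by (meson inj_onD)
qed (use assms in \<open>simp add: permutes_states_def lquot_append\<close>)

lemma permutes_states_concat:
  assumes "\<And>x. x \<in> set w \<Longrightarrow> permutes_states Q x"
  shows "permutes_states Q (concat w)"
  using assms
proof (induction w)
  case Nil
  show ?case by (simp add: permutes_states_def inj_on_def)
next
  case (Cons x w)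
  then show ?case by (simp add: permutes_states_append)
qed

text \<open>Pumping says that \<open>word_pow z n\<close> sends \<open>lquot z q\<close> and
  \<open>q\<close> to the same state; injectivity cancels this power.\<close>

lemma idempotent_permutation_trivial:
  assumes "pumpable R n q" "permutes_states Q z" "R z (z @ z)" "q \<in> Q"
  shows "lquot z q = q"
proof -
  have "permutes_states Q (word_pow z n)"
    by (rule permutes_states_concat) (use assms(2) in simp)
  moreover have "lquot (word_pow z n) (lquot z q) = lquot (word_pow z n) q"
    using assms(1,3) by (simp add: pumpable_def lquot_append)
  moreover have "lquot z q \<in> Q" using assms(2,4) by (simp add: permutes_states_def)
  ultimately show ?thesis using assms(4) unfolding permutes_states_def by (meson inj_onD)
qed

text \<open>In the group case the class of a word determines its action: if \<open>x\<close> and \<open>y\<close> are congruent and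
  \<open>y\<^sup>k\<close> is idempotent modulo the congruence, then so is \<open>x y\<^sup>k\<^sup>-\<^sup>1\<close>, and both act trivially by pumping.\<close>

lemma permutation_determined_by_class:
  assumes R: "fin_cong D R" and Q: "\<And>q. q \<in> Q \<Longrightarrow> pumpable R n q"
    and x: "permutes_states Q x" and y: "permutes_states Q y" and xy: "R x y" and q: "q \<in> Q"
  shows "lquot x q = lquot y q"
proof -
  obtain k where k: "R (word_pow y (Suc k)) (word_pow y (Suc k) @ word_pow y (Suc k))"
    using idempotent_power_exists[OF R] by blast
  let ?z = "x @ word_pow y k"
  have yk: "permutes_states Q (word_pow y k)"
    by (rule permutes_states_concat) (use y in simp)
  have eq: "R ?z (word_pow y (Suc k))"
    using fin_cong_append[OF R xy fin_cong_refl[OF R], of "word_pow y k"] by simp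
  have "R ?z (?z @ ?z)"
    using fin_cong_trans[OF R fin_cong_trans[OF R eq k]
        fin_cong_append[OF R fin_cong_sym[OF R eq] fin_cong_sym[OF R eq]]] .
  then have "lquot ?z q = q"
    using idempotent_permutation_trivial[OF Q[OF q] permutes_states_append[OF x yk] _ q] by blast
  moreover have "lquot (y @ word_pow y k) q = q"
    using idempotent_permutation_trivial[OF Q[OF q] permutes_states_append[OF y yk] _ q] k by simp
  ultimately have "lquot (word_pow y k) (lquot x q) = lquot (word_pow y k) (lquot y q)"
    by (simp add: lquot_append)
  moreover have "lquot x q \<in> Q" "lquot y q \<in> Q" using x y q by (auto simp: permutes_states_def)
  ultimately show ?thesis using yk unfolding permutes_states_def by (meson inj_onD)
qed

lemma future_action_permutation:
  assumes R: "fin_cong D R" and Q: "\<And>q. q \<in> Q \<Longrightarrow> pumpable R n q" and X: "finite X"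
    and perm: "\<And>x. x \<in> X \<Longrightarrow> permutes_states Q x" and p: "p \<in> Q"
  shows "{w \<in> lists X. lquot (concat w) p = q} \<in> future_langs R X"
proof -
  \<comment> \<open>The closure of the wanted words under \<open>R\<close>. Words over
    \<open>X\<close> that it adds act on \<open>p\<close> in the same way, since the class
    determines the action.\<close>
  let ?L = "{u. \<exists>w\<in>lists X. lquot (concat w) p = q \<and> R (concat w) u}"
  have "{w \<in> lists X. lquot (concat w) p = q} = {w \<in> lists X. concat w \<in> ?L}"
  proof (intro Collect_cong conj_cong refl iffI)
    fix w assume w: "w \<in> lists X"
    show "concat w \<in> ?L" if "lquot (concat w) p = q" using w that fin_cong_refl[OF R] by blast
    assume "concat w \<in> ?L"
    then obtain w' where w': "w' \<in> lists X" "lquot (concat w') p = q" "R (concat w') (concat w)" by blast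
    have "permutes_states Q (concat v)" if "v \<in> lists X" for v
      by (rule permutes_states_concat) (use that perm in auto)
    then show "lquot (concat w) p = q"
      using permutation_determined_by_class[OF R Q _ _ w'(3) p] w w'(1,2) by simp
  qed
  moreover have "saturated R ?L"
    unfolding saturated_def
  proof (intro allI impI)
    fix u v assume uv: "R u v" and "u \<in> ?L"
    then obtain w where "w \<in> lists X" "lquot (concat w) p = q" "R (concat w) u" by blast
    then show "v \<in> ?L" using fin_cong_trans[OF R _ uv] by blast
  qed
  ultimately show ?thesis by (simp only: future_concat[OF X])
qed

section \<open>Reduction at a non-injective letter\<close>

lemma finite_image_factor:
  assumes "finite (k ` A)" "\<And>x y. x \<in> A \<Longrightarrow> y \<in> A \<Longrightarrow> k x = k y \<Longrightarrow> f x = f y"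
  shows "finite (f ` A)"
proof -
  have "f ` A \<subseteq> (\<lambda>z. f (inv_into A k z)) ` (k ` A)"
  proof (rule image_subsetI)
    fix x assume x: "x \<in> A"
    have "f x = f (inv_into A k (k x))"
      using assms(2)[OF x inv_into_into[of "k x" k A]] f_inv_into_f[of "k x" k A] x by simp
    then show "f x \<in> (\<lambda>z. f (inv_into A k z)) ` (k ` A)" using x by blast
  qed
  then show ?thesis using assms(1) by (meson finite_imageI finite_subset)
qed

lemma future_action_step:
  assumes R: "fin_cong D R" and Q: "finite Q" and X: "finite X"
    and stable: "\<And>x q. x \<in> X \<Longrightarrow> q \<in> Q \<Longrightarrow> lquot x q \<in> Q" and c: "c \<in> X"
    and IHQ: "\<And>Y p q. finite Y \<Longrightarrow> (\<And>y q. y \<in> Y \<Longrightarrow> q \<in> lquot c ` Q \<Longrightarrow> lquot y q \<in> lquot c ` Q) \<Longrightarrow>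
        p \<in> lquot c ` Q \<Longrightarrow> {w \<in> lists Y. lquot (concat w) p = q} \<in> future_langs R Y"
    and IHX: "\<And>p q. p \<in> Q \<Longrightarrow> {w \<in> lists (X - {c}). lquot (concat w) p = q} \<in> future_langs R (X - {c})"
    and p: "p \<in> Q"
  shows "{w \<in> lists X. lquot (concat w) p = q} \<in> future_langs R X"
proof -
  let ?B = "X - {c}" and ?Q' = "lquot c ` Q"
  have stable_concat: "lquot (concat w) t \<in> Q" if "w \<in> lists X" "t \<in> Q" for w t
    using that
  proof (induction w arbitrary: t rule: list.induct)
    case (Cons x w)
    then show ?case by (simp add: lquot_append stable)
  qed simp
  have B_lists: "v \<in> lists X" if "v \<in> lists ?B" for v using that by auto
  have Q'_sub: "?Q' \<subseteq> Q" using stable[OF c] by blast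
  \<comment> \<open>A representative has to remember the class modulo \<open>R\<close>, which the
    modalities test, and the action on \<open>Q\<close>. Finitely many such pairs occur, so
    \<open>Y\<close> is finite.\<close>
  define eqv where "eqv u v \<longleftrightarrow> R u v \<and> (\<forall>q\<in>Q. lquot u q = lquot v q)" for u v
  define rep where "rep u = (SOME v. eqv u v)" for u
  define Y where "Y = (\<lambda>v. rep (concat v @ c)) ` lists ?B"
  have eqv_rep: "eqv u (rep u)" for u
    unfolding rep_def by (rule someI[of _ u]) (simp add: eqv_def fin_cong_refl[OF R])
  have eqv_sym: "eqv v u" if "eqv u v" for u v
    using that fin_cong_sym[OF R] unfolding eqv_def by simp
  have eqv_trans: "eqv u w" if "eqv u v" "eqv v w" for u v w
    using that fin_cong_trans[OF R, of u v w] unfolding eqv_def by simp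
  have rep_eq_iff: "rep u = rep v \<longleftrightarrow> eqv u v" for u v
  proof
    assume "rep u = rep v"
    then show "eqv u v" using eqv_trans[OF eqv_rep[of u]] eqv_sym[OF eqv_rep[of v]] by simp
  next
    assume "eqv u v"
    then have "eqv u = eqv v" using eqv_trans[of u v] eqv_trans[of v u] eqv_sym[of u v] by (intro ext) blast
    then show "rep u = rep v" by (simp add: rep_def)
  qed
  have rep_R: "R u (rep u)" and rep_action: "\<And>t. t \<in> Q \<Longrightarrow> lquot (rep u) t = lquot u t" for u
    using eqv_rep[of u] by (auto simp: eqv_def)
  have finY: "finite Y"
    unfolding Y_def
  proof (rule finite_image_factor)
    \<comment> \<open>The action is recorded as its graph on \<open>Q\<close>, a subset of the
      finite set \<open>Q \<times> Q\<close>.\<close>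
    let ?k = "\<lambda>v. ({u. R (concat v @ c) u}, (\<lambda>q. (q, lquot (concat v @ c) q)) ` Q)"
    have "?k ` lists ?B \<subseteq> range (\<lambda>u. {v. R u v}) \<times> Pow (Q \<times> Q)"
    proof (rule image_subsetI)
      fix v assume "v \<in> lists ?B"
      then have "lquot (concat v @ c) t \<in> Q" if "t \<in> Q" for t
        using stable[OF c stable_concat[OF B_lists that]] by (simp add: lquot_append)
      then show "?k v \<in> range (\<lambda>u. {v. R u v}) \<times> Pow (Q \<times> Q)" by auto
    qed
    then show "finite (?k ` lists ?B)"
      by (rule finite_subset) (intro finite_SigmaI fin_cong_finite[OF R], simp add: Q)
    fix u v assume "?k u = ?k v"
    then have 1: "{w. R (concat u @ c) w} = {w. R (concat v @ c) w}"
      and 2: "(\<lambda>q. (q, lquot (concat u @ c) q)) ` Q = (\<lambda>q. (q, lquot (concat v @ c) q)) ` Q" by auto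
    have "R (concat u @ c) (concat v @ c)" using 1 fin_cong_refl[OF R, of "concat v @ c"] by blast
    moreover have "lquot (concat u @ c) t = lquot (concat v @ c) t" if "t \<in> Q" for t
    proof -
      have "(t, lquot (concat u @ c) t) \<in> (\<lambda>q. (q, lquot (concat v @ c) q)) ` Q"
        using that unfolding 2[symmetric] by blast
      then show ?thesis by blast
    qed
    ultimately show "rep (concat u @ c) = rep (concat v @ c)"
      unfolding rep_eq_iff eqv_def by blast
  qed
  have fibre: "{v \<in> lists ?B. rep (concat v @ c) = y} \<in> future_langs R ?B" if y: "y \<in> Y" for y
  proof -
    obtain v0 where v0: "v0 \<in> lists ?B" "y = rep (concat v0 @ c)" using y unfolding Y_def by blast
    let ?z = "concat v0 @ c"
    \<comment> \<open>\<open>?E\<close> tests the class of the block on the concatenation.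
      \<open>?A\<close> tests its action: \<open>IHX\<close> gives the state reached by
      \<open>v\<close>, and finitely many states lead under \<open>c\<close> to the required
      one.\<close>
    let ?E = "{v \<in> lists ?B. concat v \<in> {u. R (u @ c) ?z}}"
    let ?A = "{v \<in> lists ?B. \<forall>t\<in>Q. lquot (concat v @ c) t = lquot ?z t}"
    have "saturated R {u. R (u @ c) ?z}"
      unfolding saturated_def
    proof (intro allI impI)
      fix u v assume uv: "R u v" and "u \<in> {u. R (u @ c) ?z}"
      then have "R (u @ c) ?z" by simp
      then have "R (v @ c) ?z"
        by (rule fin_cong_trans[OF R fin_cong_append[OF R fin_cong_sym[OF R uv] fin_cong_refl[OF R]]])
      then show "v \<in> {u. R (u @ c) ?z}" by simp
    qed
    then have E: "?E \<in> future_langs R ?B" using X by (intro future_concat) auto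
    have A: "?A \<in> future_langs R ?B"
    proof (rule future_ball[OF Q])
      fix t assume t: "t \<in> Q"
      have "{v \<in> lists ?B. lquot (concat v @ c) t = lquot ?z t} =
          (\<Union>s\<in>{s \<in> Q. lquot c s = lquot ?z t}. {v \<in> lists ?B. lquot (concat v) t = s})"
      proof (intro equalityI subsetI)
        fix v assume v: "v \<in> {v \<in> lists ?B. lquot (concat v @ c) t = lquot ?z t}"
        then have "lquot (concat v) t \<in> Q" using stable_concat[OF B_lists t] by blast
        then show "v \<in> (\<Union>s\<in>{s \<in> Q. lquot c s = lquot ?z t}. {v \<in> lists ?B. lquot (concat v) t = s})"
          using v by (simp add: lquot_append)
      next
        fix v assume "v \<in> (\<Union>s\<in>{s \<in> Q. lquot c s = lquot ?z t}. {v \<in> lists ?B. lquot (concat v) t = s})"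
        then have "v \<in> lists ?B" "lquot c (lquot (concat v) t) = lquot ?z t" by blast+
        then show "v \<in> {v \<in> lists ?B. lquot (concat v @ c) t = lquot ?z t}"
          by (simp add: lquot_append)
      qed
      moreover have "(\<Union>s\<in>{s \<in> Q. lquot c s = lquot ?z t}. {v \<in> lists ?B. lquot (concat v) t = s})
          \<in> future_langs R ?B"
        by (intro future_UN IHX t) (simp add: Q)
      ultimately show "{v \<in> lists ?B. lquot (concat v @ c) t = lquot ?z t} \<in> future_langs R ?B" by simp
    qed
    have "{v \<in> lists ?B. rep (concat v @ c) = y} = ?E \<inter> ?A"
      unfolding v0(2) rep_eq_iff eqv_def by blast
    then show ?thesis using future_inter[OF E A] by simp
  qed
  have Y_stable: "lquot y t \<in> ?Q'" if y: "y \<in> Y" and t': "t \<in> ?Q'" for y t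
  proof -
    obtain v where v: "v \<in> lists ?B" "y = rep (concat v @ c)" using y unfolding Y_def by blast
    have t: "t \<in> Q" using t' Q'_sub by blast
    have "lquot y t = lquot c (lquot (concat v) t)"
      using rep_action[OF t] v(2) by (simp add: lquot_append)
    then show ?thesis using stable_concat[OF B_lists[OF v(1)] t] by simp
  qed
  have vimage: "{w \<in> lists X. lquot (concat (blocks rep c [] w)) t = s} \<in> future_langs R X"
    if "t \<in> ?Q'" for t s
  proof -
    have "{w \<in> lists X. blocks rep c [] w \<in> {w \<in> lists Y. lquot (concat w) t = s}} \<in> future_langs R X"
      by (rule future_blocks_vimage[OF R rep_R c Y_def fibre IHQ[OF finY Y_stable that]])
    moreover have "blocks rep c [] w \<in> lists Y" if "w \<in> lists X" for w
      unfolding Y_def by (rule blocks_lists[OF that])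
    then have "{w \<in> lists X. blocks rep c [] w \<in> {w \<in> lists Y. lquot (concat w) t = s}} =
        {w \<in> lists X. lquot (concat (blocks rep c [] w)) t = s}" by blast
    ultimately show ?thesis by simp
  qed
  \<comment> \<open>For \<open>V\<close> over \<open>?B\<close> these are the words whose part after
    the last \<open>c\<close> lies in \<open>V\<close>: as words of \<open>V\<close> avoid
    \<open>c\<close>, the \<open>c\<close> found by the until must be the last one.\<close>
  define tail where "tail V = V \<union> until_lang UNIV (lists X) ((#) c ` V)" for V
  have tail_future: "tail V \<in> future_langs R X" if "V \<in> future_langs R ?B" for V
    unfolding tail_def
    by (intro future_union future_until saturated_UNIV future_lists future_Cons c
        future_remove_subset[OF c that])
  have tail_iff: "x @ c # v \<in> tail V \<longleftrightarrow> v \<in> V"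
    if V: "V \<subseteq> lists ?B" and w: "x @ c # v \<in> lists X" "c \<notin> set v" for x v V
  proof
    assume "v \<in> V"
    then have "x @ c # v \<in> until_lang UNIV (lists X) ((#) c ` V)"
      using w(1) by (intro until_langI[OF refl]) auto
    then show "x @ c # v \<in> tail V" unfolding tail_def by blast
  next
    assume "x @ c # v \<in> tail V"
    moreover have "x @ c # v \<notin> V" using V by auto
    ultimately have "x @ c # v \<in> until_lang UNIV (lists X) ((#) c ` V)" unfolding tail_def by blast
    then obtain x' v'' where "x @ c # v = x' @ v''" "v'' \<in> (#) c ` V" by (rule until_langE)
    then obtain v' where "x @ c # v = x' @ c # v'" "v' \<in> V" by blast
    moreover have "c \<notin> set v'" using V \<open>v' \<in> V\<close> by auto
    ultimately show "v \<in> V" using last_occurrence_unique[of x c v x' v'] w(2) by simp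
  qed
  have tail_free: "w \<in> tail V \<longleftrightarrow> w \<in> V" if "c \<notin> set w" for w V
  proof -
    have "w \<notin> until_lang UNIV (lists X) ((#) c ` V)"
    proof
      assume "w \<in> until_lang UNIV (lists X) ((#) c ` V)"
      then obtain x v where "w = x @ v" "v \<in> (#) c ` V" by (rule until_langE)
      then show False using that by auto
    qed
    then show ?thesis unfolding tail_def by blast
  qed
  have rest: "{w \<in> lists X. lquot (concat w) t = q} \<in> future_langs R X" if t: "t \<in> ?Q'" for t
  proof -
    let ?V = "\<lambda>s. {v \<in> lists ?B. lquot (concat v) s = q}"
    let ?K = "\<lambda>s. {w \<in> lists X. lquot (concat (blocks rep c [] w)) t = s}"
    have tQ: "t \<in> Q" using t Q'_sub by blast
    \<comment> \<open>\<open>s\<close> guesses the state after the last \<open>c\<close>.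
      \<open>?K s\<close> checks it on the complete blocks, since \<open>blocks\<close> drops the
      rest, and \<open>tail (?V s)\<close> checks the run from \<open>s\<close> on that rest.
      Without any \<open>c\<close> the state is still \<open>t\<close>.\<close>
    have "{w \<in> lists X. lquot (concat w) t = q} = (\<Union>s\<in>?Q'. ?K s \<inter> tail (?V s))"
    proof -
      have pick: "(\<exists>s\<in>?Q'. w \<in> ?K s \<inter> tail (?V s)) \<longleftrightarrow> w \<in> tail (?V s0)"
        if "w \<in> lists X" "lquot (concat (blocks rep c [] w)) t = s0" "s0 \<in> ?Q'" for w s0
      proof
        assume "w \<in> tail (?V s0)"
        moreover have "w \<in> ?K s0" using that by simp
        ultimately show "\<exists>s\<in>?Q'. w \<in> ?K s \<inter> tail (?V s)" using that(3) by (intro bexI[of _ s0] IntI)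
      next
        assume "\<exists>s\<in>?Q'. w \<in> ?K s \<inter> tail (?V s)"
        then obtain s where "w \<in> ?K s" "w \<in> tail (?V s)" by (elim bexE IntE)
        moreover from this(1) have "s = s0" using \<open>lquot (concat (blocks rep c [] w)) t = s0\<close> by simp
        ultimately show "w \<in> tail (?V s0)" by simp
      qed
      have iff: "lquot (concat w) t = q \<longleftrightarrow> (\<exists>s\<in>?Q'. w \<in> ?K s \<inter> tail (?V s))" if w: "w \<in> lists X" for w
      proof (cases "c \<in> set w")
        case True
        then obtain x v where xv: "w = x @ c # v" "c \<notin> set v" by (meson split_list_last)
        have x: "x \<in> lists X" and v: "v \<in> lists ?B" using w xv by auto
        let ?s = "lquot (concat x @ c) t"
        have s: "?s \<in> ?Q'" using stable_concat[OF x tQ] by (simp add: lquot_append)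
        have "blocks rep c [] w = blocks rep c [] (x @ [c])"
          using blocks_append[of rep c "[]" x v] blocks_mark_free[OF xv(2)] xv(1) by simp
        then have "lquot (concat (blocks rep c [] w)) t = ?s"
          using blocks_action[OF rep_action stable c x _ tQ, of "[]"] by simp
        then have "(\<exists>s\<in>?Q'. w \<in> ?K s \<inter> tail (?V s)) \<longleftrightarrow> w \<in> tail (?V ?s)"
          by (rule pick[OF w _ s])
        also have "\<dots> \<longleftrightarrow> v \<in> ?V ?s" using tail_iff[of "?V ?s" x v] w xv by blast
        also have "\<dots> \<longleftrightarrow> lquot (concat w) t = q" using v xv(1) by (simp add: lquot_append)
        finally show ?thesis by simp
      next
        case False
        then have "lquot (concat (blocks rep c [] w)) t = t" by (simp add: blocks_mark_free)
        then have "(\<exists>s\<in>?Q'. w \<in> ?K s \<inter> tail (?V s)) \<longleftrightarrow> w \<in> tail (?V t)"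
          by (rule pick[OF w _ t])
        also have "\<dots> \<longleftrightarrow> w \<in> ?V t" by (rule tail_free[OF False])
        also have "\<dots> \<longleftrightarrow> lquot (concat w) t = q" using w False lists_remove_iff[of w X c] by simp
        finally show ?thesis by simp
      qed
      show ?thesis
      proof (intro equalityI subsetI)
        fix w assume "w \<in> {w \<in> lists X. lquot (concat w) t = q}"
        then have "\<exists>s\<in>?Q'. w \<in> ?K s \<inter> tail (?V s)" using iff[of w] by simp
        then show "w \<in> (\<Union>s\<in>?Q'. ?K s \<inter> tail (?V s))" by (elim bexE) (rule UN_I)
      next
        fix w assume "w \<in> (\<Union>s\<in>?Q'. ?K s \<inter> tail (?V s))"
        then obtain s where s: "s \<in> ?Q'" "w \<in> ?K s \<inter> tail (?V s)" by (rule UN_E)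
        then have w: "w \<in> lists X" by simp
        have "lquot (concat w) t = q" unfolding iff[OF w] using s by (rule bexI[rotated])
        then show "w \<in> {w \<in> lists X. lquot (concat w) t = q}" using w by simp
      qed
    qed
    moreover have "(\<Union>s\<in>?Q'. ?K s \<inter> tail (?V s)) \<in> future_langs R X"
    proof (rule future_UN)
      fix s assume "s \<in> ?Q'"
      then have "s \<in> Q" using Q'_sub by blast
      then show "?K s \<inter> tail (?V s) \<in> future_langs R X"
        by (intro future_inter vimage[OF t] tail_future IHX)
    qed (simp add: Q)
    ultimately show ?thesis by simp
  qed
  let ?V = "\<lambda>t. {v \<in> lists ?B. lquot (concat v) p = t}"
  let ?S = "\<lambda>t. {w \<in> lists X. lquot (concat w) (lquot c t) = q}"
  \<comment> \<open>Here \<open>t\<close> is the state just before the first \<open>c\<close>; after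
    it the run continues from \<open>lquot c t\<close>, a state of the smaller set
    \<open>?Q'\<close>.\<close>
  have "{w \<in> lists X. lquot (concat w) p = q} = ?V q \<union> (\<Union>t\<in>Q. mark_conc c (?V t) (?S t))"
  proof (intro equalityI subsetI)
    fix w assume w: "w \<in> {w \<in> lists X. lquot (concat w) p = q}"
    show "w \<in> ?V q \<union> (\<Union>t\<in>Q. mark_conc c (?V t) (?S t))"
    proof (cases "c \<in> set w")
      case True
      then obtain v r where v: "w = v @ c # r" "c \<notin> set v" by (meson split_list_first)
      have vr: "v \<in> lists ?B" "r \<in> lists X" using w v by auto
      let ?t = "lquot (concat v) p"
      have "?t \<in> Q" using stable_concat[OF B_lists[OF vr(1)] p] .
      moreover have "v \<in> ?V ?t" "r \<in> ?S ?t" using vr w v(1) by (simp_all add: lquot_append)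
      ultimately show ?thesis using v(1) by blast
    next
      case False
      then show ?thesis using w by auto
    qed
  next
    fix w assume "w \<in> ?V q \<union> (\<Union>t\<in>Q. mark_conc c (?V t) (?S t))"
    then show "w \<in> {w \<in> lists X. lquot (concat w) p = q}"
    proof
      assume "w \<in> (\<Union>t\<in>Q. mark_conc c (?V t) (?S t))"
      then obtain t v r where "w = v @ c # r" "v \<in> ?V t" "r \<in> ?S t" by blast
      then show ?thesis using c B_lists[of v] by (simp add: lquot_append)
    qed (use B_lists in blast)
  qed
  moreover have "?V q \<union> (\<Union>t\<in>Q. mark_conc c (?V t) (?S t)) \<in> future_langs R X"
    by (intro future_union future_UN Q future_remove_subset[OF c] future_mark_conc[OF c] IHX p rest) simp
  ultimately show ?thesis by simp
qed

text \<open>Lexicographic induction, states outside and letters inside: passing to blocks may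
  enlarge the alphabet but strictly reduces the states, while removing \<open>c\<close> keeps the
  states.\<close>

lemma future_action:
  assumes R: "fin_cong D R"
  shows "finite Q \<Longrightarrow> finite X \<Longrightarrow> (\<And>q. q \<in> Q \<Longrightarrow> pumpable R n q) \<Longrightarrow>
    (\<And>x q. x \<in> X \<Longrightarrow> q \<in> Q \<Longrightarrow> lquot x q \<in> Q) \<Longrightarrow> p \<in> Q \<Longrightarrow>
    {w \<in> lists X. lquot (concat w) p = q} \<in> future_langs R X"
proof (induction "card Q" arbitrary: Q X p q rule: less_induct)
  case (less Q)
  note outer = less.hyps and finQ = less.prems(1) and pump = less.prems(3)
  show ?case using less.prems(2,4,5)
  proof (induction "card X" arbitrary: X p q rule: less_induct)
    case (less X)
    note finX = less.prems(1) and stable = less.prems(2) and p = less.prems(3)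
    show ?case
    proof (cases "\<forall>x\<in>X. inj_on (lquot x) Q")
      case True
      have "permutes_states Q x" if "x \<in> X" for x
        using True that stable by (simp add: permutes_states_def)
      with pump finX show ?thesis by (rule future_action_permutation[OF R _ _ _ p])
    next
      case False
      then obtain c where c: "c \<in> X" "\<not> inj_on (lquot c) Q" by blast
      have card_Q: "card (lquot c ` Q) < card Q"
        using c(2) card_image_le[OF finQ, of "lquot c"] eq_card_imp_inj_on[OF finQ, of "lquot c"]
        by linarith
      have sub: "lquot c ` Q \<subseteq> Q" using stable[OF c(1)] by blast
      show ?thesis
      proof (rule future_action_step[OF R finQ finX stable c(1) _ _ p])
        fix Y t s
        assume Y: "finite Y" "\<And>y q. y \<in> Y \<Longrightarrow> q \<in> lquot c ` Q \<Longrightarrow> lquot y q \<in> lquot c ` Q" "t \<in> lquot c ` Q"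
        have "pumpable R n q" if "q \<in> lquot c ` Q" for q
          by (rule pump) (use that sub in blast)
        then show "{w \<in> lists Y. lquot (concat w) t = s} \<in> future_langs R Y"
          by (rule outer[OF card_Q finite_imageI[OF finQ] Y(1) _ Y(2,3)])
      next
        fix t s assume "t \<in> Q"
        have "card (X - {c}) < card X" by (rule card_Diff1_less[OF finX c(1)])
        moreover have "finite (X - {c})" using finX by simp
        moreover have "lquot x q \<in> Q" if "x \<in> X - {c}" "q \<in> Q" for x q using that stable by simp
        ultimately show "{w \<in> lists (X - {c}). lquot (concat w) t = s} \<in> future_langs R (X - {c})"
          using \<open>t \<in> Q\<close> by (rule less.hyps)
      qed
    qed
  qed
qed

section \<open>Pumping in the star-free closure\<close>

definition pumps :: "('a list \<Rightarrow> 'a list \<Rightarrow> bool) \<Rightarrow> nat \<Rightarrow> 'a list set \<Rightarrow> bool" where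
  "pumps R n L \<longleftrightarrow> (\<forall>x u v. R x (x @ x) \<longrightarrow>
    (u @ word_pow x n @ v \<in> L \<longleftrightarrow> u @ word_pow x (Suc n) @ v \<in> L))"

lemma pumpsD:
  "pumps R n L \<Longrightarrow> R x (x @ x) \<Longrightarrow> u @ word_pow x n @ v \<in> L \<longleftrightarrow> u @ word_pow x (Suc n) @ v \<in> L"
  unfolding pumps_def by blast

lemma pumps_imp_pumpable: "pumps R n L \<Longrightarrow> pumpable R n (lquot u L)"
  unfolding pumpable_def lquot_def by (simp add: pumpsD[of R n L] del: replicate.simps)

lemma pumps_mono:
  assumes "pumps R n L" "n \<le> m" "\<And>u v. S u v \<Longrightarrow> R u v"
  shows "pumps S m L"
  unfolding pumps_def
proof (intro allI impI)
  fix x u v assume "S x (x @ x)"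
  then have x: "R x (x @ x)" by (rule assms(3))
  obtain k where k: "m = n + k" using assms(2) le_Suc_ex by blast
  have "u @ word_pow x m @ v \<in> L \<longleftrightarrow> u @ word_pow x n @ (word_pow x k @ v) \<in> L"
    unfolding k word_pow_add by simp
  also have "\<dots> \<longleftrightarrow> u @ word_pow x (Suc n) @ (word_pow x k @ v) \<in> L" by (rule pumpsD[OF assms(1) x])
  also have "\<dots> \<longleftrightarrow> u @ word_pow x (Suc m) @ v \<in> L"
    unfolding k add_Suc[symmetric] word_pow_add by simp
  finally show "u @ word_pow x m @ v \<in> L \<longleftrightarrow> u @ word_pow x (Suc m) @ v \<in> L" .
qed

text \<open>With \<open>k + m\<close> copies of \<open>x\<close>, the cut between the factors comes
  after the first \<open>k\<close> copies or before the last \<open>m\<close>. So one of the two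
  factors contains enough copies to change their number.\<close>

lemma pumps_conc_shift:
  assumes L: "\<And>u v. u @ word_pow x k @ v \<in> L \<Longrightarrow> u @ word_pow x k' @ v \<in> L"
    and K: "\<And>u v. u @ word_pow x m @ v \<in> K \<Longrightarrow> u @ word_pow x m' @ v \<in> K"
    and eq: "k' + m = N'" "k + m' = N'"
    and w: "u @ word_pow x (k + m) @ v \<in> conc L K"
  shows "u @ word_pow x N' @ v \<in> conc L K"
proof -
  obtain p q where pq: "(u @ word_pow x k) @ (word_pow x m @ v) = p @ q" "p \<in> L" "q \<in> K"
    using w unfolding word_pow_add conc_def by auto
  from pq(1) consider t where "p = (u @ word_pow x k) @ t" "word_pow x m @ v = t @ q"
    | t where "u @ word_pow x k = p @ t" "q = t @ word_pow x m @ v"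
    unfolding append_eq_append_conv2[of "u @ word_pow x k" "word_pow x m @ v" p q] by blast
  then show ?thesis
  proof cases
    case 1
    then have "u @ word_pow x k' @ t \<in> L" using L[of u t] pq(2) by simp
    then have "(u @ word_pow x k' @ t) @ q \<in> conc L K"
      using pq(3) unfolding conc_def by blast
    moreover have "(u @ word_pow x k' @ t) @ q = u @ word_pow x N' @ v"
      unfolding eq(1)[symmetric] word_pow_add using 1(2) by simp
    ultimately show ?thesis by simp
  next
    case 2
    then have "p @ (t @ word_pow x m' @ v) \<in> conc L K"
      using K[of t v] pq(2,3) unfolding conc_def by blast
    moreover have "p @ t @ word_pow x m' @ v = u @ word_pow x N' @ v"
      unfolding eq(2)[symmetric] word_pow_add append_assoc[symmetric] 2(1)[symmetric] by simp
    ultimately show ?thesis by simp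
  qed
qed

text \<open>The exponent \<open>2n + 1\<close> is forced by removing a copy: among
  \<open>2n + 2\<close> copies the cut leaves \<open>n + 1\<close> on one of its sides, which
  suffices to go down to \<open>n\<close>. For adding one, \<open>n\<close> copies on the left or
  \<open>n + 1\<close> on the right suffice.\<close>

lemma pumps_conc:
  assumes L: "pumps R n L" and K: "pumps R n K"
  shows "pumps R (Suc (n + n)) (conc L K)"
  unfolding pumps_def
proof (intro allI impI iffI)
  fix x u v assume x: "R x (x @ x)"
  have K': "pumps R (Suc n) K" by (rule pumps_mono[OF K]) auto
  {
    assume "u @ word_pow x (Suc (n + n)) @ v \<in> conc L K"
    then have "u @ word_pow x (n + Suc n) @ v \<in> conc L K" by simp
    then show "u @ word_pow x (Suc (Suc (n + n))) @ v \<in> conc L K"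
      by (rule pumps_conc_shift[rotated -1, where k' = "Suc n" and m' = "Suc (Suc n)"])
        (use pumpsD[OF L x] pumpsD[OF K' x] in simp_all)
  next
    assume "u @ word_pow x (Suc (Suc (n + n))) @ v \<in> conc L K"
    then have "u @ word_pow x (Suc n + Suc n) @ v \<in> conc L K" by simp
    then show "u @ word_pow x (Suc (n + n)) @ v \<in> conc L K"
      by (rule pumps_conc_shift[rotated -1, where k' = n and m' = n])
        (use pumpsD[OF L x] pumpsD[OF K x] in simp_all)
  }
qed

text \<open>A base language is a union of classes, so \<open>x\<close> may be replaced by
  \<open>x @ x\<close> and the exponent is 1. Refining the congruence only removes idempotents, so
  two congruences can be intersected and two exponents added.\<close>

lemma SF_pumps:
  assumes C: "prevariety C" and "L \<in> SF C"
  shows "\<exists>R n. fin_cong C R \<and> pumps R n L"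
  using assms(2)
proof (induction rule: SF.induct)
  case (SF_base L)
  obtain R where R: "fin_cong C R" "saturated R L"
    using fin_cong_exists[OF prevariety_quotient_algebra[OF C] SF_base] by blast
  have "u @ word_pow x 1 @ v \<in> L \<longleftrightarrow> u @ word_pow x (Suc 1) @ v \<in> L" if "R x (x @ x)" for x u v
  proof (rule saturated_iff[OF R])
    show "R (u @ word_pow x 1 @ v) (u @ word_pow x (Suc 1) @ v)"
      using that by (intro fin_cong_append[OF R(1)] fin_cong_refl[OF R(1)]) simp
  qed
  then have "pumps R 1 L" unfolding pumps_def by blast
  then show ?case using R(1) by blast
next
  case (SF_letter a)
  obtain R where R: "fin_cong C R"
    using fin_cong_exists_finite[OF prevariety_quotient_algebra[OF C], of "{}"] by blast
  \<comment> \<open>The exponent 2 makes a nonempty power longer than one letter; with exponent 1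
    the word \<open>x = [a]\<close> would be a counterexample whenever it is idempotent.\<close>
  have "u @ word_pow x 2 @ v = [a] \<longleftrightarrow> u @ word_pow x (Suc 2) @ v = [a]" for x u v
  proof (cases x)
    case (Cons b y)
    have "length (u @ word_pow x 2 @ v) \<noteq> length [a]" "length (u @ word_pow x (Suc 2) @ v) \<noteq> length [a]"
      by (simp_all add: Cons numeral_2_eq_2)
    then show ?thesis by metis
  qed simp
  then have "pumps R 2 {[a]}" unfolding pumps_def by simp
  then show ?case using R by blast
next
  case (SF_union L K)
  then obtain R n S m where RS: "fin_cong C R" "pumps R n L" "fin_cong C S" "pumps S m K" by blast
  let ?T = "\<lambda>u v. R u v \<and> S u v"
  have "pumps ?T (n + m) L" "pumps ?T (n + m) K"
    by (rule pumps_mono[OF RS(2)], auto) (rule pumps_mono[OF RS(4)], auto)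
  then have "pumps ?T (n + m) (L \<union> K)" unfolding pumps_def by blast
  then show ?case using fin_cong_inf[OF prevariety_quotient_algebra[OF C] RS(1,3)] by blast
next
  case (SF_compl L)
  then show ?case unfolding pumps_def by blast
next
  case (SF_conc L K)
  then obtain R n S m where RS: "fin_cong C R" "pumps R n L" "fin_cong C S" "pumps S m K" by blast
  let ?T = "\<lambda>u v. R u v \<and> S u v"
  have "pumps ?T (n + m) L" "pumps ?T (n + m) K"
    by (rule pumps_mono[OF RS(2)], auto) (rule pumps_mono[OF RS(4)], auto)
  then have "pumps ?T (Suc ((n + m) + (n + m))) (conc L K)" by (rule pumps_conc)
  then show ?case using fin_cong_inf[OF prevariety_quotient_algebra[OF C] RS(1,3)] by blast
qed

section \<open>From star-free expressions to future formulas\<close>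

text \<open>Position \<open>Suc i\<close> sees the suffix \<open>drop i w\<close>;
  \<open>i = length w\<close> is the end position, with the empty suffix. Position 0 carries no
  letter and is treated separately by one next step.\<close>

definition future_definable :: "'a list set set \<Rightarrow> 'a list set \<Rightarrow> bool" where
  "future_definable C V \<longleftrightarrow> (\<exists>\<phi>. mlangs \<phi> \<subseteq> C \<and> future \<phi> \<and>
    (\<forall>w i. i \<le> length w \<longrightarrow> sat w (Suc i) \<phi> = (drop i w \<in> V)))"

lemma future_definable_empty: "future_definable C {}"
  unfolding future_definable_def by (rule exI[of _ "Neg TT"]) simp

lemma future_definable_union:
  assumes "future_definable C V" "future_definable C W"
  shows "future_definable C (V \<union> W)"
proof -
  obtain \<phi> \<psi> where "mlangs \<phi> \<subseteq> C" "future \<phi>" "\<And>w i. i \<le> length w \<Longrightarrow> sat w (Suc i) \<phi> = (drop i w \<in> V)"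
    "mlangs \<psi> \<subseteq> C" "future \<psi>" "\<And>w i. i \<le> length w \<Longrightarrow> sat w (Suc i) \<psi> = (drop i w \<in> W)"
    using assms unfolding future_definable_def by metis
  then show ?thesis unfolding future_definable_def by (intro exI[of _ "Or \<phi> \<psi>"]) simp
qed

lemma future_definable_compl:
  assumes "future_definable C V"
  shows "future_definable C (- V)"
proof -
  obtain \<phi> where "mlangs \<phi> \<subseteq> C" "future \<phi>" "\<And>w i. i \<le> length w \<Longrightarrow> sat w (Suc i) \<phi> = (drop i w \<in> V)"
    using assms unfolding future_definable_def by metis
  then show ?thesis unfolding future_definable_def by (intro exI[of _ "Neg \<phi>"]) simp
qed

lemma future_definable_inter:
  assumes "future_definable C V" "future_definable C W"
  shows "future_definable C (V \<inter> W)"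
proof -
  have "V \<inter> W = - (- V \<union> - W)" by blast
  then show ?thesis using assms by (simp only: future_definable_compl future_definable_union)
qed

lemma future_definable_UN:
  assumes "finite A" "\<And>a. a \<in> A \<Longrightarrow> future_definable C (V a)"
  shows "future_definable C (\<Union>a\<in>A. V a)"
  using assms by induction (auto intro: future_definable_empty future_definable_union)

text \<open>The strict modality of the logic at a position labelled \<open>a\<close>: the current
  letter is neither part of \<open>x\<close> nor subject to \<open>P\<close>.\<close>

definition strict_until :: "'a \<Rightarrow> 'a list set \<Rightarrow> 'a list set \<Rightarrow> 'a list set \<Rightarrow> 'a list set" where
  "strict_until a L P S = {a # x @ t | x t. x \<in> L \<and> t \<in> S \<and>
    (\<forall>x1 c x2. x = x1 @ c # x2 \<longrightarrow> c # x2 @ t \<in> P)}"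

lemma future_definable_strict_until:
  assumes "L \<in> C" "future_definable C P" "future_definable C S"
  shows "future_definable C (strict_until a L P S)"
proof -
  obtain f g where f: "mlangs f \<subseteq> C" "future f" "\<And>w i. i \<le> length w \<Longrightarrow> sat w (Suc i) f = (drop i w \<in> P)"
    and g: "mlangs g \<subseteq> C" "future g" "\<And>w i. i \<le> length w \<Longrightarrow> sat w (Suc i) g = (drop i w \<in> S)"
    using assms(2,3) unfolding future_definable_def by metis
  have "sat w (Suc i) (And (Lab a) (Until L f g)) = (drop i w \<in> strict_until a L P S)"
    if i: "i \<le> length w" for w i
  proof (cases "i < length w \<and> w ! i = a")
    case True
    define p s where "p = take (Suc i) w" and "s = drop (Suc i) w"
    have w: "w = p @ s" and len: "length p = Suc i" using True by (auto simp: p_def s_def)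
    have d: "drop i w = a # s" using True by (auto simp: s_def Cons_nth_drop_Suc[symmetric])
    have fg: "sat (p @ s) (Suc (length p + length x)) f = (t \<in> P)"
      "sat (p @ s) (Suc (length p + length x)) g = (t \<in> S)" if "s = x @ t" for x t
      using f(3)[of "length p + length x" "p @ s"] g(3)[of "length p + length x" "p @ s"] that by auto
    have "sat w (Suc i) (Until L f g) \<longleftrightarrow>
      (\<exists>x t. s = x @ t \<and> x \<in> L \<and> t \<in> S \<and> (\<forall>x1 c x2. x = x1 @ c # x2 \<longrightarrow> c # x2 @ t \<in> P))"
      (is "_ \<longleftrightarrow> ?r")
    proof -
      have "sat w (Suc i) (Until L f g) \<longleftrightarrow> sat (p @ s) (length p) (Until L f g)"
        by (simp only: w[symmetric] len)
      also have "\<dots> \<longleftrightarrow> (\<exists>x t. s = x @ t \<and> x \<in> L \<and> t \<in> S \<and>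
          (\<forall>x1 c x2. x = x1 @ c # x2 \<longrightarrow> c # x2 @ t \<in> P))"
        unfolding sat_Until_append
      proof (intro ex_cong1 conj_cong refl all_cong1 imp_cong)
        fix x t assume "s = x @ t"
        then show "sat (p @ s) (Suc (length p + length x)) g = (t \<in> S)" by (rule fg)
        fix x1 c x2 assume "x = x1 @ c # x2"
        then show "sat (p @ s) (Suc (length p + length x1)) f = (c # x2 @ t \<in> P)"
          using fg(1)[of x1 "c # x2 @ t"] \<open>s = x @ t\<close> by simp
      qed
      finally show ?thesis .
    qed
    also have "\<dots> \<longleftrightarrow> drop i w \<in> strict_until a L P S"
      unfolding d strict_until_def by blast
    finally show ?thesis using True by (simp del: sat.simps(8))
  next
    case False
    have "drop i w \<notin> strict_until a L P S"
    proof
      assume "drop i w \<in> strict_until a L P S"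
      then obtain r where r: "drop i w = a # r" unfolding strict_until_def by blast
      then have "i < length w" by (cases "i < length w") auto
      then show False using False r nth_via_drop[OF r] by simp
    qed
    then show ?thesis using False by auto
  qed
  then show ?thesis
    unfolding future_definable_def using assms(1) f(1,2) g(1,2)
    by (intro exI[of _ "And (Lab a) (Until L f g)"]) (simp del: sat.simps)
qed

lemma concat_map_singleton: "concat (map (\<lambda>a. [a]) w) = w"
  by (induction w) auto

lemma future_langs_definable:
  fixes C :: "'a::finite list set set"
  assumes C: "prevariety C" and R: "fin_cong C R" and "V \<in> future_langs R (range (\<lambda>a. [a]))"
  shows "future_definable C {w. map (\<lambda>a. [a]) w \<in> V}"
  using assms(3)
proof (induction rule: future_langs.induct)
  case future_empty
  then show ?case by (simp add: future_definable_empty)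
next
  case (future_union P S)
  then show ?case by (simp add: Collect_disj_eq future_definable_union)
next
  case (future_compl P)
  have "{w :: 'a list. map (\<lambda>a. [a]) w \<in> lists (range (\<lambda>a. [a])) - P} = - {w. map (\<lambda>a. [a]) w \<in> P}"
    by auto
  then show ?case using future_definable_compl[OF future_compl.IH] by simp
next
  case (future_Cons x P)
  then obtain a where x: "x = [a]" by blast
  \<comment> \<open>The unsatisfiable left argument excludes inner positions, so this until is the
    next modality.\<close>
  have "{w. map (\<lambda>a. [a]) w \<in> (#) x ` P} = strict_until a UNIV {} {w. map (\<lambda>a. [a]) w \<in> P}"
  proof (intro equalityI subsetI)
    fix w assume "w \<in> {w. map (\<lambda>a. [a]) w \<in> (#) x ` P}"
    then obtain t where "w = a # [] @ t" "map (\<lambda>a. [a]) t \<in> P" unfolding x by (cases w) auto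
    then show "w \<in> strict_until a UNIV {} {w. map (\<lambda>a. [a]) w \<in> P}"
      unfolding strict_until_def by blast
  next
    fix w assume "w \<in> strict_until a UNIV {} {w. map (\<lambda>a. [a]) w \<in> P}"
    then obtain y t where w: "w = a # y @ t" "map (\<lambda>a. [a]) t \<in> P"
        "\<forall>x1 c x2. y = x1 @ c # x2 \<longrightarrow> False"
      unfolding strict_until_def by blast
    then have "y = []" using w(3)[rule_format, of "[]"] by (cases y) auto
    then show "w \<in> {w. map (\<lambda>a. [a]) w \<in> (#) x ` P}" using w(1,2) x by simp
  qed
  moreover have "UNIV \<in> C" using C by (simp add: prevariety_def)
  ultimately show ?case
    using future_definable_strict_until[OF _ future_definable_empty future_Cons.IH] by simp
next
  case (future_until L P S)
  let ?P = "{w. map (\<lambda>a. [a]) w \<in> P}" and ?S = "{w. map (\<lambda>a. [a]) w \<in> S}"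
  have L: "L \<in> C"
    by (rule fin_cong_saturated_mem[OF prevariety_quotient_algebra[OF C] R future_until.hyps(1)])
  then have lq: "lquot [a] L \<in> C" for a using C by (simp add: prevariety_def)
  \<comment> \<open>From non-strict to strict until: the current letter \<open>a\<close> is guessed,
    removed from \<open>L\<close> by a left quotient, and tested against \<open>P\<close>
    separately. Closure of \<open>C\<close> under left quotients enters here.\<close>
  have "{w. map (\<lambda>a. [a]) w \<in> until_lang L P S} =
    (if [] \<in> L then ?S else {}) \<union> (\<Union>a. ?P \<inter> strict_until a (lquot [a] L) ?P ?S)" (is "?l = ?r")
  proof (intro equalityI subsetI)
    fix w assume "w \<in> ?l"
    then have "map (\<lambda>a. [a]) w \<in> until_lang L P S" by simp
    then obtain u v where uv: "map (\<lambda>a. [a]) w = u @ v" "concat u \<in> L" "v \<in> S"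
      "\<forall>u1 u2. u = u1 @ u2 \<longrightarrow> u2 \<noteq> [] \<longrightarrow> u2 @ v \<in> P"
      by (rule until_langE)
    then obtain u' v' where w: "w = u' @ v'" "u = map (\<lambda>a. [a]) u'" "v = map (\<lambda>a. [a]) v'"
      unfolding map_eq_append_conv by blast
    show "w \<in> ?r"
    proof (cases u')
      case Nil
      then show ?thesis using uv(2,3) w by simp
    next
      case (Cons a x)
      have P: "w \<in> ?P" using uv(1) uv(4)[rule_format, of "[]" u] w(2) Cons by simp
      have xL: "x \<in> lquot [a] L" using uv(2) w(2) Cons by (simp add: lquot_def concat_map_singleton)
      have vS: "v' \<in> ?S" using uv(3) w(3) by simp
      have "\<forall>x1 c x2. x = x1 @ c # x2 \<longrightarrow> c # x2 @ v' \<in> ?P"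
      proof (intro allI impI)
        fix x1 c x2 assume "x = x1 @ c # x2"
        then show "c # x2 @ v' \<in> ?P"
          using uv(4)[rule_format, of "map (\<lambda>a. [a]) (a # x1)" "map (\<lambda>a. [a]) (c # x2)"] w Cons by simp
      qed
      then have "a # x @ v' \<in> strict_until a (lquot [a] L) ?P ?S"
        unfolding strict_until_def using xL vS by blast
      then show ?thesis using P w(1) Cons by auto
    qed
  next
    fix w assume w: "w \<in> ?r"
    show "w \<in> ?l"
    proof (cases "[] \<in> L \<and> w \<in> ?S")
      case True
      then have "map (\<lambda>a. [a]) w \<in> until_lang L P S"
        by (intro until_langI[of _ "[]"]) auto
      then show ?thesis by simp
    next
      case False
      then obtain a where P: "w \<in> ?P" and "w \<in> strict_until a (lquot [a] L) ?P ?S"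
        using w by (auto split: if_splits)
      then obtain x t where x: "w = a # x @ t" "x \<in> lquot [a] L" "t \<in> ?S"
        "\<forall>x1 c x2. x = x1 @ c # x2 \<longrightarrow> c # x2 @ t \<in> ?P" unfolding strict_until_def by blast
      have "map (\<lambda>a. [a]) w \<in> until_lang L P S"
      proof (rule until_langI)
        show "map (\<lambda>a. [a]) w = map (\<lambda>a. [a]) (a # x) @ map (\<lambda>a. [a]) t" using x(1) by simp
        show "concat (map (\<lambda>a. [a]) (a # x)) \<in> L"
          using x(2) by (simp only: concat_map_singleton) (simp add: lquot_def)
        show "map (\<lambda>a. [a]) t \<in> S" using x(3) by simp
        fix u1 u2 assume u: "map (\<lambda>a. [a]) (a # x) = u1 @ u2" "u2 \<noteq> []"
        show "u2 @ map (\<lambda>a. [a]) t \<in> P"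
        proof (cases u1)
          case Nil
          then show ?thesis using P x(1) u by auto
        next
          case (Cons b u3)
          then have "map (\<lambda>a. [a]) x = u3 @ u2" using u(1) by simp
          then obtain x1 y where y: "x = x1 @ y" "u2 = map (\<lambda>a. [a]) y"
            unfolding map_eq_append_conv by blast
          then obtain c x2 where "y = c # x2" using u(2) by (cases y) auto
          then show ?thesis using x(4)[rule_format, of x1 c x2] y by simp
        qed
      qed
      then show ?thesis by simp
    qed
  qed
  moreover have "future_definable C (if [] \<in> L then ?S else {})"
    using future_until.IH(2) by (simp add: future_definable_empty)
  moreover have "future_definable C (\<Union>a. ?P \<inter> strict_until a (lquot [a] L) ?P ?S)"
    by (intro future_definable_UN future_definable_inter future_until.IH
        future_definable_strict_until lq) simp
  ultimately show ?case by (simp only: future_definable_union)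
qed

lemma future_definable_LTL:
  fixes C :: "'a::finite list set set"
  assumes C: "prevariety C" and "future_definable C V"
  shows "V \<in> LTL C"
proof -
  obtain \<phi> where \<phi>: "mlangs \<phi> \<subseteq> C" "future \<phi>"
    "\<And>w i. i \<le> length w \<Longrightarrow> sat w (Suc i) \<phi> = (drop i w \<in> V)"
    using assms(2) unfolding future_definable_def by metis
  \<comment> \<open>A next modality that moves from the unlabelled position 0 to position 1, whose
    suffix is the whole word.\<close>
  let ?\<psi> = "Until UNIV (Neg TT) \<phi>"
  have "sat w 0 ?\<psi> \<longleftrightarrow> w \<in> V" for w
  proof -
    have "sat w 0 ?\<psi> \<longleftrightarrow> sat w 1 \<phi>"
    proof
      assume "sat w 0 ?\<psi>"
      then obtain j where j: "0 < j" "sat w j \<phi>" "\<forall>k. \<not> (0 < k \<and> k < j)" by auto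
      then have "j = 1" using j(3)[rule_format, of 1] by linarith
      then show "sat w 1 \<phi>" using j(2) by simp
    qed auto
    then show ?thesis using \<phi>(3)[of 0 w] by simp
  qed
  then have "V = lang_of ?\<psi>" unfolding lang_of_def by blast
  moreover have "mlangs ?\<psi> \<subseteq> C" "future ?\<psi>" using \<phi>(1,2) C by (auto simp: prevariety_def)
  ultimately show ?thesis unfolding LTL_def by blast
qed

lemma SF_subset_LTL:
  fixes C :: "'a::finite list set set"
  assumes C: "prevariety C"
  shows "SF C \<subseteq> LTL C"
proof
  fix K assume K: "K \<in> SF C"
  obtain R n where R: "fin_cong C R" "pumps R n K" using SF_pumps[OF C K] by blast
  \<comment> \<open>The states of the minimal automaton of \<open>K\<close>, with initial state
    \<open>K\<close>; a state accepts iff it contains the empty word.\<close>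
  let ?Q = "range (\<lambda>u. lquot u K)" and ?X = "range (\<lambda>a :: 'a. [a])"
  have finQ: "finite ?Q" using SF_finite_index[OF C K] by (simp add: finite_index_def)
  have KQ: "K \<in> ?Q" by (rule image_eqI[of _ _ "[]"]) simp_all
  have stable: "lquot x q \<in> ?Q" if "q \<in> ?Q" for x q
    using that by (auto simp: lquot_append[symmetric])
  have action: "{w \<in> lists ?X. lquot (concat w) K = q} \<in> future_langs R ?X" for q
    by (rule future_action[OF R(1) finQ _ _ _ KQ]) (auto intro: pumps_imp_pumpable[OF R(2)] stable)
  have mem: "concat w \<in> K \<longleftrightarrow> [] \<in> lquot (concat w) K" for w by (simp add: lquot_def)
  have "{w \<in> lists ?X. concat w \<in> K} =
      (\<Union>q\<in>{q \<in> ?Q. [] \<in> q}. {w \<in> lists ?X. lquot (concat w) K = q})"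
    unfolding mem by blast
  then have "{w \<in> lists ?X. concat w \<in> K} \<in> future_langs R ?X"
    using future_UN[OF _ action, of "{q \<in> ?Q. [] \<in> q}"] finQ by simp
  then have "future_definable C {w. map (\<lambda>a. [a]) w \<in> {w \<in> lists ?X. concat w \<in> K}}"
    by (rule future_langs_definable[OF C R(1)])
  moreover have "{w. map (\<lambda>a. [a]) w \<in> {w \<in> lists ?X. concat w \<in> K}} = K"
    by (auto simp: concat_map_singleton)
  ultimately show "K \<in> LTL C" by (simp add: future_definable_LTL[OF C])
qed

theorem theorem7p4:
  fixes C :: "('a::finite) list set set"
  assumes "prevariety C"
  shows "SF C = LTL C \<and> LTL C = LTLP C"
proof -
  have "LTL C \<subseteq> LTLP C" by (auto simp: LTL_def LTLP_def)
  then show ?thesis using SF_subset_LTL[OF assms] LTLP_subset_SF[OF assms] by blast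
qed

end
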